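(* Let $N\ge 1$, $M\ge 0$ be integers, let $c,\delta_{x_1},\dots,\delta_{x_N},\delta_{y_1},\dots,\delta_{y_M}\in\mathbb{C}$ be arbitrary, and let $\mathcal{L}_n$ ($n\in\mathbb{Z}$) be the operators on $\mathcal{F}$ defined in the context. Then for all $n,m\in\mathbb{Z}$ $$[\mathcal{L}_n,\mathcal{L}_m]=(n-m)\,\mathcal{L}_{n+m}+\frac{c}{12}(n^3-n)\,\delta_{n+m,0},$$ so that the $\mathcal{L}_n$ form a representation of the Virasoro algebra on $\mathcal{F}$ (with central charge $c$). Equivalently, the generating series $\mathcal{T}(\zeta)=\sum_{n\in\mathbb{Z}}\zeta^{-2-n}\mathcal{L}_n$ satisfies, in $(\mathrm{End}\,\mathcal{F})[[\zeta,\zeta^{-1},\xi,\xi^{-1}]]$, $$[\mathcal{T}(\zeta),\mathcal{T}(\xi)]=\frac{1}{3!}\,\partial_\xi^3\delta(\zeta-\xi)\;\frac{c}{2}+\partial_\xi\delta(\zeta-\xi)\;2\,\mathcal{T}(\xi)+\delta(\zeta-\xi)\;\mathcal{T}'(\xi).$$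
   Context: Function space. Let $S\subset\mathbb{R}^{N+M}$ be the open set of points $(x_1,\dots,x_N,y_1,\dots,y_M)$ with pairwise distinct coordinates that are ordered on the real line in one fixed prescribed order. $\mathcal{F}=C^\infty(S\to\mathbb{C})[f_{-2},f_{-3},\dots]$ is the algebra of polynomials in the indeterminates $f_{-2},f_{-3},\dots$ with coefficients smooth complex functions on $S$. Formal series. $f(z)=z+\sum_{m\le -2}f_m z^{1+m}$, regarded as a formal Laurent series at $z=\infty$ with coefficients in $\mathbb{C}[f_{-2},f_{-3},\dots]$; $f',f'',f'''$ are formal derivatives in $z$, $Sf=\frac{f'''}{f'}-\frac32\left(\frac{f''}{f'}\right)^2$, and quotients and negative powers are expanded in $z^{-1}$. $\mathrm{Res}_z\sum_m a_mz^m=a_{-1}$. For $j\ge 0$, $$\Big(\frac{1}{(f(z)-r)^{1+j}}\Big)_{|f(z)|>|r|}=\sum_{m\ge 0}\binom{m}{j}f(z)^{-1-m}r^{m-j},$$ where $r$ may be a variable or another series such as $f(u)$. The formal delta function is $\delta(\zeta-\xi)=\sum_{n\in\mathbb{Z}}\zeta^{-1-n}\xi^n$. Operators. For $n\in\mathbb{Z}$, $\mathcal{L}_n:\mathcal{F}\to\mathcal{F}$ is $$\mathcal{L}_n=\mathrm{Res}_u\,u^{1-n}\Big\{\frac{c}{12}Sf(u)-\sum_{l\le-2}\mathrm{Res}_z\,f'(u)^2z^{-2-l}\Big(\frac{1}{f(z)-f(u)}\Big)_{|f(z)|>|f(u)|}\frac{\partial}{\partial f_l}$$ $$+\sum_{I=1}^N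 f'(u)^2\Big(\delta_{x_I}\Big(\frac{1}{(f(u)-x_I)^2}\Big)_{|f(u)|>|x_I|}+\Big(\frac{1}{f(u)-x_I}\Big)_{|f(u)|>|x_I|}\frac{\partial}{\partial x_I}\Big)$$ $$+\sum_{K=1}^M f'(u)^2\Big(\delta_{y_K}\Big(\frac{1}{(f(u)-y_K)^2}\Big)_{|f(u)|>|y_K|}+\Big(\frac{1}{f(u)-y_K}\Big)_{|f(u)|>|y_K|}\frac{\partial}{\partial y_K}\Big)\Big\}.$$ All coefficients are polynomials in the $x_I,y_K,f_l$, acting by multiplication after the derivative, and only finitely many $\partial/\partial f_l$ terms act nontrivially on a given element of $\mathcal{F}$. The Virasoro algebra is the Lie algebra with basis $L_n$ ($n\in\mathbb{Z}$), $C$, with $C$ central and $[L_n,L_m]=(n-m)L_{n+m}+\frac1{12}(n^3-n)\delta_{n+m,0}C$; central charge $c$ means $C$ acts as multiplication by $c$. *)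

theory Defs
  imports
    "HOL-Analysis.Analysis"
    "HOL-Library.Poly_Mapping"
    "HOL-Computational_Algebra.Formal_Laurent_Series"
begin

no_notation fps_nth (infixl \<open>$\<close> 75)

section \<open>Smooth functions on the set of ordered configurations\<close>

text \<open>The real coordinates are indexed by a finite type \<open>'d\<close>; the prescribed order of the
  coordinates on the real line is the linear order of \<open>'d\<close>.\<close>

definition configs :: "(real ^ 'd::{finite,linorder}) set" where
  "configs = {p. \<forall>i j. i < j \<longrightarrow> p $ i < p $ j}"

primrec Ck_on ::
    "nat \<Rightarrow> 'a::real_normed_vector set \<Rightarrow> ('a \<Rightarrow> 'b::real_normed_vector) \<Rightarrow> bool" where
  "Ck_on 0 S g \<longleftrightarrow> continuous_on S g"
| "Ck_on (Suc k) S g \<longleftrightarrow>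
     (\<forall>x\<in>S. g differentiable (at x)) \<and> (\<forall>v. Ck_on k S (\<lambda>x. frechet_derivative g (at x) v))"

definition Cinf_on ::
    "'a::real_normed_vector set \<Rightarrow> ('a \<Rightarrow> 'b::real_normed_vector) \<Rightarrow> bool" where
  "Cinf_on S g \<longleftrightarrow> (\<forall>k. Ck_on k S g)"

lemma open_configs: "open (configs :: (real ^ 'd::{finite,linorder}) set)"
proof -
  have "(configs :: (real, 'd) vec set) = (\<Inter>i. \<Inter>j\<in>{j. i < j}. {p. p $ i < p $ j})"
    by (auto simp: configs_def)
  also have "open \<dots>"
    by (intro open_INT ballI open_Collect_less continuous_intros) auto
  finally show ?thesis .
qed

lemma Ck_on_cong:
  assumes "open S" "\<And>x. x \<in> S \<Longrightarrow> g x = h x" "Ck_on k S g"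
  shows "Ck_on k S h"
  using assms(2,3)
proof (induction k arbitrary: g h)
  case 0
  then show ?case using continuous_on_eq[of S g h] by auto
next
  case (Suc k)
  have der: "(h has_derivative frechet_derivative g (at x)) (at x)" if "x \<in> S" for x
    using Suc.prems that assms(1)
    by (intro has_derivative_transform_within_open[of g _ x _ S h])
       (auto simp: frechet_derivative_works)
  have eq: "frechet_derivative g (at x) = frechet_derivative h (at x)" if "x \<in> S" for x
    using frechet_derivative_at[OF der[OF that]] .
  have "Ck_on k S (\<lambda>x. frechet_derivative h (at x) v)" for v
  proof -
    have "Ck_on k S (\<lambda>x. frechet_derivative g (at x) v)"
      using Suc.prems(2) by simp
    from Suc.IH[OF _ this] show ?thesis by (simp add: eq)
  qed
  then show ?case using der by (auto simp: differentiable_def)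
qed

lemma Ck_on_Suc_imp: "Ck_on (Suc k) S g \<Longrightarrow> Ck_on k S g"
proof (induction k arbitrary: g)
  case 0
  then show ?case
    by (auto intro!: continuous_at_imp_continuous_on differentiable_imp_continuous_within)
next
  case (Suc k)
  have "Ck_on k S (\<lambda>x. frechet_derivative g (at x) v)" for v
    using Suc.prems by (intro Suc.IH) auto
  with Suc.prems show ?case by auto
qed

lemma Ck_on_const: "Ck_on k S (\<lambda>_. a)"
  by (induction k arbitrary: a) (auto intro: continuous_intros)

lemma Ck_on_bounded_linear:
  assumes "bounded_linear g"
  shows "Ck_on k S g"
proof (cases k)
  case 0
  then show ?thesis using assms by (simp add: linear_continuous_on)
next
  case (Suc n)
  have "frechet_derivative g (at x) = g" for x
    using frechet_derivative_at[OF bounded_linear_imp_has_derivative[OF assms]] by metis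
  then show ?thesis
    unfolding Suc by (simp add: Ck_on_const bounded_linear_imp_differentiable[OF assms])
qed

lemma Ck_on_add:
  assumes "open S" "Ck_on k S g" "Ck_on k S h"
  shows "Ck_on k S (\<lambda>x. g x + h x)"
  using assms(2,3)
proof (induction k arbitrary: g h)
  case 0
  then show ?case by (auto intro: continuous_intros)
next
  case (Suc k)
  have "Ck_on k S (\<lambda>x. frechet_derivative (\<lambda>x. g x + h x) (at x) v)" for v
  proof (rule Ck_on_cong[OF assms(1)])
    show "Ck_on k S (\<lambda>x. frechet_derivative g (at x) v + frechet_derivative h (at x) v)"
      using Suc.prems by (intro Suc.IH) auto
    fix x assume "x \<in> S"
    then have "((\<lambda>x. g x + h x) has_derivative
        (\<lambda>v. frechet_derivative g (at x) v + frechet_derivative h (at x) v)) (at x)"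
      using Suc.prems by (intro has_derivative_add) (auto simp: frechet_derivative_works)
    from frechet_derivative_at[OF this]
    show "frechet_derivative g (at x) v + frechet_derivative h (at x) v =
        frechet_derivative (\<lambda>x. g x + h x) (at x) v" by metis
  qed
  then show ?case using Suc.prems by auto
qed

lemma Ck_on_mult:
  fixes g h :: "'a::real_normed_vector \<Rightarrow> 'b::real_normed_algebra"
  assumes "open S" "Ck_on k S g" "Ck_on k S h"
  shows "Ck_on k S (\<lambda>x. g x * h x)"
  using assms(2,3)
proof (induction k arbitrary: g h)
  case 0
  then show ?case by (auto intro: continuous_intros)
next
  case (Suc k)
  have "Ck_on k S (\<lambda>x. frechet_derivative (\<lambda>x. g x * h x) (at x) v)" for v
  proof (rule Ck_on_cong[OF assms(1)])
    show "Ck_on k S (\<lambda>x. g x * frechet_derivative h (at x) v + frechet_derivative g (at x) v * h x)"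
      using Suc.prems Ck_on_Suc_imp[OF Suc.prems(1)] Ck_on_Suc_imp[OF Suc.prems(2)]
      by (intro Suc.IH Ck_on_add[OF assms(1)]) simp_all
    fix x assume "x \<in> S"
    then have "((\<lambda>x. g x * h x) has_derivative
        (\<lambda>v. g x * frechet_derivative h (at x) v + frechet_derivative g (at x) v * h x)) (at x)"
      using Suc.prems by (intro has_derivative_mult) (auto simp: frechet_derivative_works)
    from frechet_derivative_at[OF this]
    show "g x * frechet_derivative h (at x) v + frechet_derivative g (at x) v * h x =
        frechet_derivative (\<lambda>x. g x * h x) (at x) v" by metis
  qed
  then show ?case using Suc.prems by auto
qed

text \<open>A function on \<open>configs\<close> is represented by its extension by zero to the whole space.\<close>

typedef (overloaded) ('d::"{finite,linorder}") cinf =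
  "{g :: (real, 'd) vec \<Rightarrow> complex. Cinf_on configs g \<and> (\<forall>p. p \<notin> configs \<longrightarrow> g p = 0)}"
  by (rule exI[of _ "\<lambda>_. 0"]) (auto simp: Cinf_on_def Ck_on_const)

setup_lifting type_definition_cinf

lemma Cinf_on_restrict:
  fixes g :: "real ^ 'd::{finite,linorder} \<Rightarrow> complex"
  assumes "\<And>k. Ck_on k configs g"
  shows "Cinf_on configs (\<lambda>p. if p \<in> configs then g p else 0)"
  unfolding Cinf_on_def
  using Ck_on_cong[OF open_configs, of g "\<lambda>p. if p \<in> configs then g p else 0"] assms by auto

instantiation cinf :: ("{finite,linorder}") comm_ring_1
begin

lift_definition zero_cinf :: "'a cinf" is "\<lambda>_. 0"
  by (auto simp: Cinf_on_def Ck_on_const)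

lift_definition one_cinf :: "'a cinf" is "\<lambda>p. if p \<in> configs then 1 else 0"
  by (auto intro!: Cinf_on_restrict Ck_on_const)

lift_definition plus_cinf :: "'a cinf \<Rightarrow> 'a cinf \<Rightarrow> 'a cinf" is "\<lambda>g h p. g p + h p"
  by (auto simp: Cinf_on_def intro!: Ck_on_add[OF open_configs])

lift_definition times_cinf :: "'a cinf \<Rightarrow> 'a cinf \<Rightarrow> 'a cinf" is "\<lambda>g h p. g p * h p"
  by (auto simp: Cinf_on_def intro!: Ck_on_mult[OF open_configs])

lift_definition uminus_cinf :: "'a cinf \<Rightarrow> 'a cinf" is "\<lambda>g p. - g p"
proof -
  fix g :: "(real, 'a) vec \<Rightarrow> complex"
  assume g: "Cinf_on configs g \<and> (\<forall>p. p \<notin> configs \<longrightarrow> g p = 0)"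
  then have "Ck_on k configs (\<lambda>p. (- 1) * g p)" for k
    by (intro Ck_on_mult[OF open_configs] Ck_on_const) (auto simp: Cinf_on_def)
  with g show "Cinf_on configs (\<lambda>p. - g p) \<and> (\<forall>p. p \<notin> configs \<longrightarrow> - g p = 0)"
    by (simp add: Cinf_on_def)
qed

definition minus_cinf :: "'a cinf \<Rightarrow> 'a cinf \<Rightarrow> 'a cinf" where
  "minus_cinf g h = g + (- h)"

instance
proof
  have "\<exists>p :: (real, 'a) vec. p \<in> configs"
  proof -
    let ?p = "\<chi> i. real (card {j::'a. j < i})"
    have "card {k. k < i} < card {k. k < j}" if "i < j" for i j :: 'a
      using that by (intro psubset_card_mono) (auto dest: less_trans)
    then have "?p \<in> configs" by (auto simp: configs_def)
    then show ?thesis by blast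
  qed
  then show "(0 :: 'a cinf) \<noteq> 1"
    by transfer (metis zero_neq_one)
qed (simp_all add: minus_cinf_def, (transfer; auto simp: algebra_simps fun_eq_iff)+)

end

lift_definition cconst :: "complex \<Rightarrow> 'd::{finite,linorder} cinf"
  is "\<lambda>a p. if p \<in> configs then a else 0"
  by (auto intro!: Cinf_on_restrict Ck_on_const)

lift_definition coord :: "'d::{finite,linorder} \<Rightarrow> 'd cinf"
  is "\<lambda>i p. if p \<in> configs then complex_of_real (p $ i) else 0"
  by (auto intro!: Cinf_on_restrict Ck_on_bounded_linear
      bounded_linear_compose[OF bounded_linear_of_real bounded_linear_vec_nth])

lift_definition partial :: "'d::{finite,linorder} \<Rightarrow> 'd cinf \<Rightarrow> 'd cinf"
  is "\<lambda>i g p. if p \<in> configs then frechet_derivative g (at p) (axis i 1) else 0"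
proof -
  fix i :: 'd and g :: "(real, 'd) vec \<Rightarrow> complex"
  assume "Cinf_on configs g \<and> (\<forall>p. p \<notin> configs \<longrightarrow> g p = 0)"
  then have "Ck_on (Suc k) configs g" for k
    unfolding Cinf_on_def by blast
  then have "Ck_on k configs (\<lambda>p. frechet_derivative g (at p) (axis i 1))" for k
    by auto
  from Cinf_on_restrict[OF this]
  show "Cinf_on configs (\<lambda>p. if p \<in> configs then frechet_derivative g (at p) (axis i 1) else 0) \<and>
      (\<forall>p. p \<notin> configs \<longrightarrow>
        (if p \<in> configs then frechet_derivative g (at p) (axis i 1) else 0) = 0)"
    by auto
qed


section \<open>The polynomial algebra over the smooth functions\<close>

text \<open>Monomials are exponent vectors \<open>nat \<Rightarrow>\<^sub>0 nat\<close>, where index \<open>k\<close> stands for the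
  indeterminate \<open>f\<close> with subscript \<open>- 2 - k\<close>.\<close>

type_synonym 'd fspace = "(nat \<Rightarrow>\<^sub>0 nat) \<Rightarrow>\<^sub>0 'd cinf"

definition findex :: "int \<Rightarrow> nat" where
  "findex m = nat (- 2 - m)"

definition coeff :: "'d::{finite,linorder} cinf \<Rightarrow> 'd fspace" where
  "coeff g = Poly_Mapping.single 0 g"

definition fvar :: "int \<Rightarrow> 'd::{finite,linorder} fspace" where
  "fvar m = Poly_Mapping.single (Poly_Mapping.single (findex m) 1) 1"

definition scalar :: "complex \<Rightarrow> 'd::{finite,linorder} fspace" where
  "scalar a = coeff (cconst a)"

definition scaleF :: "complex \<Rightarrow> 'd::{finite,linorder} fspace \<Rightarrow> 'd fspace" where
  "scaleF a P = scalar a * P"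

definition d_coord :: "'d::{finite,linorder} \<Rightarrow> 'd fspace \<Rightarrow> 'd fspace" where
  "d_coord i P = Poly_Mapping.map (partial i) P"

definition d_fvar :: "int \<Rightarrow> 'd::{finite,linorder} fspace \<Rightarrow> 'd fspace" where
  "d_fvar l P = (\<Sum>\<alpha>\<in>Poly_Mapping.keys P.
     Poly_Mapping.single (\<alpha> - Poly_Mapping.single (findex l) 1)
       (of_nat (Poly_Mapping.lookup \<alpha> (findex l)) * Poly_Mapping.lookup P \<alpha>))"

lemma finite_d_fvar: "finite {l. l \<le> - 2 \<and> d_fvar l P \<noteq> 0}"
proof (rule finite_subset)
  show "{l. l \<le> - 2 \<and> d_fvar l P \<noteq> 0} \<subseteq>
      (\<lambda>k. - 2 - int k) ` (\<Union>\<alpha>\<in>Poly_Mapping.keys P. Poly_Mapping.keys \<alpha>)"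
  proof clarify
    fix l :: int assume l: "l \<le> - 2" "d_fvar l P \<noteq> 0"
    then obtain \<alpha> where "\<alpha> \<in> Poly_Mapping.keys P" "Poly_Mapping.lookup \<alpha> (findex l) \<noteq> 0"
      unfolding d_fvar_def by (metis (no_types, lifting) mult_zero_left of_nat_0 single_zero sum.neutral)
    with l show "l \<in> (\<lambda>k. - 2 - int k) ` (\<Union>\<alpha>\<in>Poly_Mapping.keys P. Poly_Mapping.keys \<alpha>)"
      by (intro image_eqI[of _ _ "findex l"]) (auto simp: findex_def in_keys_iff)
  qed
  show "finite ((\<lambda>k. - 2 - int k) ` (\<Union>\<alpha>\<in>Poly_Mapping.keys P. Poly_Mapping.keys \<alpha>))"
    by simp
qed


section \<open>Formal Laurent series at infinity\<close>

text \<open>A formal Laurent series in \<open>z\<close> at infinity is an element of \<open>'a fls\<close> whose formal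
  variable \<open>fls_X\<close> is the inverse of \<open>z\<close>: the coefficient of $z^m$ is
  \<open>fls_nth g (- m)\<close>.\<close>

definition zpow :: "int \<Rightarrow> 'a::comm_ring_1 fls" where
  "zpow k = fls_X_intpow (- k)"

definition Res :: "'a::zero fls \<Rightarrow> 'a" where
  "Res g = fls_nth g 1"

text \<open>The derivative with respect to \<open>z\<close>, by the chain rule for the inverse variable.\<close>

definition zderiv :: "'a::comm_ring_1 fls \<Rightarrow> 'a fls" where
  "zderiv g = - (fls_X ^ 2 * fls_deriv g)"

lemma zderiv_nth: "fls_nth (zderiv g) (- m) = of_int (m + 1) * fls_nth g (- (m + 1))"
  by (simp add: zderiv_def fls_X_power_times_conv_shift algebra_simps)

text \<open>The series $z + \sum_{m \le -2} a_m z^{1+m}$.\<close>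

definition zseries :: "(int \<Rightarrow> 'a::comm_ring_1) \<Rightarrow> 'a fls" where
  "zseries a = fls_X_inv + fps_to_fls (Abs_fps (\<lambda>k. if k = 0 then 0 else a (- 1 - int k)))"

lemma zseries_nth:
  "fls_nth (zseries a) (- k) = (if k = 1 then 1 else if k \<le> - 1 then a (k - 1) else 0)"
  by (auto simp: zseries_def)

text \<open>Only series with leading coefficient 1 are inverted below, so the second argument
  of \<open>fls_right_inverse\<close> (the inverse of the leading coefficient) is 1.\<close>

definition zinv :: "'a::comm_ring_1 fls \<Rightarrow> 'a fls" where
  "zinv g = fls_right_inverse g 1"

lemma zinv_works:
  assumes "fls_nth g (fls_subdegree g) = 1"
  shows "g * zinv g = 1"
  unfolding zinv_def by (rule fls_right_inverse) (simp add: assms)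

text \<open>The expansion for \<open>|g| > |r|\<close> of \<open>1 / (g - r) ^ (1 + j)\<close>; the infinite sum
  converges in the adic topology on \<open>'a fls\<close>.\<close>

definition expand :: "nat \<Rightarrow> 'a::comm_ring_1 fls \<Rightarrow> 'a \<Rightarrow> 'a fls" where
  "expand j g r = suminf (\<lambda>m. of_nat (m choose j) * zinv g ^ (1 + m) * fls_const (r ^ (m - j)))"

lemma fls_sums_coeffwise:
  fixes t :: "nat \<Rightarrow> 'a::comm_ring_1 fls"
  assumes t: "\<And>m i. i < int m \<Longrightarrow> fls_nth (t m) i = 0"
    and l: "\<And>k n. k < int n \<Longrightarrow> fls_nth l k = (\<Sum>m<n. fls_nth (t m) k)"
  shows "t sums l"
  unfolding sums_def
proof (rule metric_LIMSEQ_I)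
  have nth: "fls_nth (sum t A) k = (\<Sum>m\<in>A. fls_nth (t m) k)" if "finite A" for A k
    using that by (induction A rule: finite_induct) auto
  fix e :: real assume "e > 0"
  then obtain n0 where n0: "inverse (2 ^ n0) < e"
    using real_arch_pow_inv[of e "1 / 2"] by (auto simp: power_divide inverse_eq_divide)
  have "dist (sum t {..<n}) l < e" if "n \<ge> n0" for n
  proof (cases "sum t {..<n} = l")
    case True
    then show ?thesis using \<open>e > 0\<close> by simp
  next
    case False
    then have deg: "fls_subdegree (sum t {..<n} - l) \<ge> int n"
      by (intro fls_subdegree_geI) (auto simp: nth l)
    then have "inverse (2 ^ nat (fls_subdegree (sum t {..<n} - l))) \<le> inverse (2 ^ n0 :: real)"
      using that by (intro le_imp_inverse_le power_increasing) auto
    also note n0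
    finally show ?thesis
      using False deg by (simp add: dist_fls_def)
  qed
  then show "\<exists>n0. \<forall>n\<ge>n0. dist (sum t {..<n}) l < e" by blast
qed

lemma expand_sums:
  fixes g :: "'a::comm_ring_1 fls"
  assumes g: "\<And>i. i \<le> 0 \<Longrightarrow> fls_nth (zinv g) i = 0"
  shows "(\<lambda>m. of_nat (m choose j) * zinv g ^ (1 + m) * fls_const (r ^ (m - j))) sums expand j g r"
    and "fls_nth (expand j g r) k =
      (\<Sum>m<nat k. of_nat (m choose j) * fls_nth (zinv g ^ (1 + m)) k * r ^ (m - j))"
proof -
  define p where "p = fps_shift 1 (fls_regpart (zinv g))"
  have zinv: "zinv g = fls_X * fps_to_fls p"
    by (rule fls_eqI) (auto simp: p_def fls_X_times_conv_shift g not_less nat_diff_distrib')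
  define t where "t m = of_nat (m choose j) * zinv g ^ (1 + m) * fls_const (r ^ (m - j))" for m
  have pow0: "fls_nth (zinv g ^ n) i = 0" if "i < int n" for n i
    using that by (simp add: zinv power_mult_distrib fls_X_power_times_conv_shift
        flip: fps_to_fls_power)
  have t_nth: "fls_nth (t m) i =
      of_nat (m choose j) * fls_nth (zinv g ^ (1 + m)) i * r ^ (m - j)" for m i
    by (simp add: t_def fls_of_nat flip: fls_const_mult_const)
  have t0: "fls_nth (t m) i = 0" if "i < int (1 + m)" for m i
    unfolding t_nth pow0[OF that] by simp
  define l where "l = Abs_fls (\<lambda>k. \<Sum>m<nat k. fls_nth (t m) k)"
  have l_nth: "fls_nth l k = (\<Sum>m<nat k. fls_nth (t m) k)" for k
    unfolding l_def by (subst nth_Abs_fls_lower_bound[of 0]) auto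
  have "t sums l"
  proof (rule fls_sums_coeffwise)
    show "fls_nth (t m) i = 0" if "i < int m" for m i
      using that by (intro t0) auto
    show "fls_nth l k = (\<Sum>m<n. fls_nth (t m) k)" if "k < int n" for k n
      unfolding l_nth using that by (intro sum.mono_neutral_left) (auto intro!: t0)
  qed
  moreover have "expand j g r = suminf t"
    unfolding expand_def t_def ..
  ultimately have l: "expand j g r = l" by (simp add: sums_iff)
  with \<open>t sums l\<close> show "(\<lambda>m. of_nat (m choose j) * zinv g ^ (1 + m) * fls_const (r ^ (m - j))) sums expand j g r"
    unfolding t_def by simp
  show "fls_nth (expand j g r) k =
      (\<Sum>m<nat k. of_nat (m choose j) * fls_nth (zinv g ^ (1 + m)) k * r ^ (m - j))"
    by (simp add: l l_nth t_nth)
qed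

lemma zinv_zseries_nth:
  fixes a :: "int \<Rightarrow> 'a::comm_ring_1"
  assumes "i \<le> 0"
  shows "fls_nth (zinv (zseries a)) i = 0"
proof -
  have "fls_subdegree (zseries a) = - 1"
  proof (rule fls_subdegree_eqI)
    show "fls_nth (zseries a) (- 1) \<noteq> 0" by (simp add: zseries_nth)
    show "fls_nth (zseries a) k = 0" if "k < - 1" for k
      using that zseries_nth[of a "- k"] by auto
  qed
  with assms show ?thesis by (simp add: zinv_def)
qed

definition schwarzian :: "'d::{finite,linorder} fspace fls \<Rightarrow> 'd fspace fls" where
  "schwarzian g =
     zderiv (zderiv (zderiv g)) * zinv (zderiv g)
     - fls_const (scalar (3 / 2)) * (zderiv (zderiv g) * zinv (zderiv g)) ^ 2"


section \<open>The operators\<close>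

text \<open>The series \<open>f(u)\<close>, and the series \<open>f(z)\<close> with coefficients in the Laurent series
  in \<open>u\<close>; double series are series in \<open>z\<close> whose coefficients are series in \<open>u\<close>.\<close>

definition f_u :: "'d::{finite,linorder} fspace fls" where
  "f_u = zseries fvar"

definition f_z :: "'d::{finite,linorder} fspace fls fls" where
  "f_z = zseries (\<lambda>m. fls_const (fvar m))"

text \<open>\<open>ix I\<close> and \<open>iy K\<close> are the indices of the coordinates $x_I$ and $y_K$.\<close>

definition Lop ::
    "complex \<Rightarrow> nat \<Rightarrow> nat \<Rightarrow> (nat \<Rightarrow> 'd) \<Rightarrow> (nat \<Rightarrow> 'd) \<Rightarrow> (nat \<Rightarrow> complex) \<Rightarrow> (nat \<Rightarrow> complex)
     \<Rightarrow> int \<Rightarrow> 'd::{finite,linorder} fspace \<Rightarrow> 'd fspace" where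
  "Lop c N M ix iy dx dy n P = Res (zpow (1 - n) *
     (fls_const (scalar (c / 12)) * schwarzian f_u * fls_const P
      - (\<Sum>l | l \<le> - 2 \<and> d_fvar l P \<noteq> 0.
           Res (fls_const (zderiv f_u ^ 2) * zpow (- 2 - l) * expand 0 f_z f_u)
           * fls_const (d_fvar l P))
      + (\<Sum>I=1..N. zderiv f_u ^ 2 *
           (fls_const (scalar (dx I)) * expand 1 f_u (coeff (coord (ix I))) * fls_const P
            + expand 0 f_u (coeff (coord (ix I))) * fls_const (d_coord (ix I) P)))
      + (\<Sum>K=1..M. zderiv f_u ^ 2 *
           (fls_const (scalar (dy K)) * expand 1 f_u (coeff (coord (iy K))) * fls_const P
            + expand 0 f_u (coeff (coord (iy K))) * fls_const (d_coord (iy K) P)))))"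


section \<open>The Virasoro algebra and its representations\<close>

datatype vir_basis = VL int | VC

type_synonym vir = "vir_basis \<Rightarrow>\<^sub>0 complex"

fun vir_basis_bracket :: "vir_basis \<Rightarrow> vir_basis \<Rightarrow> vir" where
  "vir_basis_bracket (VL n) (VL m) =
     Poly_Mapping.single (VL (n + m)) (of_int (n - m))
     + (if n + m = 0 then Poly_Mapping.single VC (1 / 12 * of_int (n ^ 3 - n)) else 0)"
| "vir_basis_bracket _ _ = 0"

definition vir_scale :: "complex \<Rightarrow> vir \<Rightarrow> vir" where
  "vir_scale s a = Poly_Mapping.map ((*) s) a"

definition vir_bracket :: "vir \<Rightarrow> vir \<Rightarrow> vir" where
  "vir_bracket a b = (\<Sum>g\<in>Poly_Mapping.keys a. \<Sum>h\<in>Poly_Mapping.keys b.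
     vir_scale (Poly_Mapping.lookup a g * Poly_Mapping.lookup b h) (vir_basis_bracket g h))"

definition vir_L :: "int \<Rightarrow> vir" where
  "vir_L n = Poly_Mapping.single (VL n) 1"

definition vir_C :: vir where
  "vir_C = Poly_Mapping.single VC 1"

definition virasoro_rep ::
    "(complex \<Rightarrow> 'v::ab_group_add \<Rightarrow> 'v) \<Rightarrow> (vir \<Rightarrow> 'v \<Rightarrow> 'v) \<Rightarrow> bool" where
  "virasoro_rep sc \<rho> \<longleftrightarrow>
     (\<forall>a. Vector_Spaces.linear sc sc (\<rho> a)) \<and>
     (\<forall>v. Vector_Spaces.linear vir_scale sc (\<lambda>a. \<rho> a v)) \<and>
     (\<forall>a b v. \<rho> (vir_bracket a b) v = \<rho> a (\<rho> b v) - \<rho> b (\<rho> a v))"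


section \<open>Formal distributions\<close>

text \<open>\<open>A k\<close> is the coefficient of $\xi^k$ in a one-variable distribution, and \<open>D a b\<close>
  that of $\zeta^a \xi^b$ in a two-variable one.  Operator-valued coefficients
  are functions on the underlying vector space.\<close>

definition delta2 :: "int \<Rightarrow> int \<Rightarrow> complex" where
  "delta2 a b = (if \<exists>n. a = - 1 - n \<and> b = n then 1 else 0)"

definition d_xi2 :: "(int \<Rightarrow> int \<Rightarrow> complex) \<Rightarrow> int \<Rightarrow> int \<Rightarrow> complex" where
  "d_xi2 D a b = of_int (b + 1) * D a (b + 1)"

definition d_dist :: "(complex \<Rightarrow> 'v \<Rightarrow> 'v) \<Rightarrow> (int \<Rightarrow> 'v \<Rightarrow> 'v) \<Rightarrow> int \<Rightarrow> 'v \<Rightarrow> 'v" where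
  "d_dist sc A k v = sc (of_int (k + 1)) (A (k + 1) v)"

text \<open>The product of \<open>D\<close>, in both variables, with \<open>A\<close>, in the variable \<open>\<xi>\<close>.  It is only used
  for \<open>D\<close> with finitely many terms for each power of \<open>\<zeta>\<close>, so that the sum is finite.\<close>

definition dist_mult ::
    "(complex \<Rightarrow> 'v \<Rightarrow> 'v) \<Rightarrow> (int \<Rightarrow> int \<Rightarrow> complex) \<Rightarrow> (int \<Rightarrow> 'v \<Rightarrow> 'v)
     \<Rightarrow> int \<Rightarrow> int \<Rightarrow> 'v \<Rightarrow> 'v::comm_monoid_add" where
  "dist_mult sc D A a b v = (\<Sum>k | D a k \<noteq> 0. sc (D a k) (A (b - k) v))"

text \<open>The series of all $\zeta^{-2-n} L_n$.\<close>

definition stress_tensor :: "(int \<Rightarrow> 'v \<Rightarrow> 'v) \<Rightarrow> int \<Rightarrow> 'v \<Rightarrow> 'v" where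
  "stress_tensor L k = L (- 2 - k)"

end

theory Submission
  imports Defs
begin

text \<open>Write $L_n P = A_n P + V_n P$ with a multiplication operator $A_n$ and a derivation $V_n$.
  Let $p_n$ be the polynomial for which $p_n(f(z)) - z^{1-n} f'(z)$ has only negative powers of $z$.
  Then $V_n f = p_n(f) - z^{1-n} f'$ and $V_n x = p_n(x)$ for each of the coordinates $x$: the
  vector field $-z^{1-n}\partial_z$ reparametrizes $f$, and $p_n$ restores the normalization of
  $f$ at infinity while dragging the points along.  Computing $[V_n, V_m] f$ and using
  that $p_{n+m}$ is unique gives $V_n p_m - V_m p_n + p_m' p_n - p_n' p_m = (n - m) p_{n+m}$,
  hence $[V_n, V_m] = (n - m) V_{n+m}$ on all generators, and, after differentiation, the cocycle
  identity for the terms $\delta_x p_n'(x)$ of $A_n$.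

  For the Schwarzian term let $D = f'^{-1}\partial$ and
  $B(X, Y) = \mathrm{Res}\, f' X D^3 Y$, which is antisymmetric and vanishes when $X, Y$ are both
  polynomials in $f$ or both have only negative powers.  As $V_n Sf = f'^2 D^3 (V_n f)$, the
  residues $S_n$ of $z^{1-n} Sf$ satisfy
  $V_n S_m - V_m S_n = - B(z^{1-m} f', z^{1-n} f')$, and the identity
  $f'^2 D^3 (v f') = v''' + 2 v' Sf + v (Sf)'$ evaluates the right-hand side to
  $(n - m) S_{n+m} + (n^3 - n) \delta_{n+m,0}$.\<close>

notation fls_nth (infixl \<open>$$\<close> 75)

section \<open>Derivations of commutative rings\<close>

text \<open>One notion covers \<open>zderiv\<close>, the partial derivatives, the vector fields on
  the polynomial algebra and their action on series. Additivity and the Leibniz rule already force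
  integers to be constants.\<close>

locale derivation =
  fixes V :: "'a::comm_ring_1 \<Rightarrow> 'a"
  assumes add: "V (a + b) = V a + V b"
    and mult: "V (a * b) = V a * b + a * V b"
begin

lemma zero [simp]: "V 0 = 0"
  using add[of 0 0] by simp

lemma one [simp]: "V 1 = 0"
  using mult[of 1 1] by simp

lemma uminus: "V (- a) = - V a"
  using add[of a "- a"] by (simp add: eq_neg_iff_add_eq_0 add.commute)

lemma diff: "V (a - b) = V a - V b"
  using add[of a "- b"] by (simp add: uminus)

lemma sum: "V (sum g A) = (\<Sum>i\<in>A. V (g i))"
  by (induction A rule: infinite_finite_induct) (simp_all add: add)

lemma of_nat [simp]: "V (of_nat n) = 0"
  by (induction n) (simp_all add: add)

lemma of_int [simp]: "V (of_int n) = 0"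
  by (cases n) (simp_all add: uminus diff add)

lemma numeral [simp]: "V (numeral n) = 0"
  using of_nat[of "numeral n"] by simp

lemma power2: "V (a ^ 2) = 2 * a * V a"
  by (simp add: power2_eq_square mult)

lemma inverse:
  assumes "a * b = 1"
  shows "V b = - (b ^ 2 * V a)"
proof -
  have "V a * b + a * V b = 0"
    using mult[of a b] assms by simp
  then have "b * (V a * b + a * V b) = 0" by simp
  then have "b ^ 2 * V a + (a * b) * V b = 0"
    by (simp add: algebra_simps power2_eq_square)
  with assms show ?thesis by (simp add: eq_neg_iff_add_eq_0 add.commute)
qed

end

section \<open>Formal Laurent series\<close>

text \<open>Convolution between arbitrary lower bounds instead of subdegrees: bounds survive
  applying a map to the coefficients, whereas the subdegree may jump when a leading coefficient is
  killed.\<close>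

lemma fls_mult_nth_lower_bound:
  fixes g h :: "'a::comm_ring_1 fls"
  assumes "\<And>i. i < a \<Longrightarrow> g $$ i = 0" "\<And>i. i < b \<Longrightarrow> h $$ i = 0"
  shows "(g * h) $$ n = (\<Sum>i=a..n - b. g $$ i * h $$ (n - i))"
proof (cases "g = 0 \<or> h = 0")
  case True
  then show ?thesis by auto
next
  case False
  then have "a \<le> fls_subdegree g" "b \<le> fls_subdegree h"
    using assms by (auto intro: fls_subdegree_geI)
  then show ?thesis
    unfolding fls_times_nth(2)
    by (intro sum.mono_neutral_left) auto
qed

lemma fls_mult_nth_below:
  fixes g h :: "'a::comm_ring_1 fls"
  assumes "\<And>i. i < a \<Longrightarrow> g $$ i = 0" "\<And>i. i < b \<Longrightarrow> h $$ i = 0" "n < a + b"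
  shows "(g * h) $$ n = 0"
  using assms(3) by (subst fls_mult_nth_lower_bound[OF assms(1,2)]) auto

lemma fls_mult_nth_lead:
  fixes g h :: "'a::comm_ring_1 fls"
  assumes "\<And>i. i < a \<Longrightarrow> g $$ i = 0" "\<And>i. i < b \<Longrightarrow> h $$ i = 0" "n = a + b"
  shows "(g * h) $$ n = g $$ a * h $$ b"
  using assms(3) by (subst fls_mult_nth_lower_bound[OF assms(1,2)]) auto

lemma fls_lower_bound_ex:
  fixes g :: "'a::zero fls"
  obtains a where "\<And>i. i < a \<Longrightarrow> g $$ i = 0"
  by (rule that[of "fls_subdegree g"]) simp

text \<open>Serves both to let a derivation act on coefficients and to embed series into double
  series. \<open>h 0 = 0\<close> keeps the support bounded below.\<close>

definition fls_map :: "('a::zero \<Rightarrow> 'b::zero) \<Rightarrow> 'a fls \<Rightarrow> 'b fls" where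
  "fls_map h g = Abs_fls (\<lambda>n. h (g $$ n))"

lemma fls_map_nth:
  assumes "h 0 = 0"
  shows "fls_map h g $$ n = h (g $$ n)"
  unfolding fls_map_def
  by (rule nth_Abs_fls_lower_bound[of "fls_subdegree g"]) (simp add: assms)

lemma fls_map_mult:
  fixes h :: "'a::comm_ring_1 \<Rightarrow> 'b::comm_ring_1"
  assumes [simp]: "h 0 = 0" and add: "\<And>a b. h (a + b) = h a + h b" and mult: "\<And>a b. h (a * b) = h a * h b"
  shows "fls_map h (g * k) = fls_map h g * fls_map h k"
proof (rule fls_eqI)
  fix n
  obtain a where a: "\<And>i. i < a \<Longrightarrow> g $$ i = 0" using fls_lower_bound_ex by blast
  obtain b where b: "\<And>i. i < b \<Longrightarrow> k $$ i = 0" using fls_lower_bound_ex by blast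
  have sum: "h (sum q A) = (\<Sum>i\<in>A. h (q i))" for q :: "int \<Rightarrow> 'a" and A
    by (induction A rule: infinite_finite_induct) (simp_all add: add)
  have "fls_map h (g * k) $$ n = (\<Sum>i=a..n - b. h (g $$ i) * h (k $$ (n - i)))"
    by (simp add: fls_map_nth fls_mult_nth_lower_bound[OF a b] sum mult)
  also have "\<dots> = (fls_map h g * fls_map h k) $$ n"
    using a b by (subst fls_mult_nth_lower_bound[of a _ b]) (simp_all add: fls_map_nth)
  finally show "fls_map h (g * k) $$ n = (fls_map h g * fls_map h k) $$ n" .
qed

context derivation
begin

text \<open>\<open>V\<close> acts on the coefficients; the formal variable is a constant for
  it.\<close>

definition lift :: "'a fls \<Rightarrow> 'a fls" where
  "lift = fls_map V"

lemma lift_nth [simp]: "lift g $$ n = V (g $$ n)"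
  by (simp add: lift_def fls_map_nth)

lemma derivation_lift: "derivation lift"
proof
  show "lift (g + h) = lift g + lift h" for g h
    by (rule fls_eqI) (simp add: add)
  show "lift (g * h) = lift g * h + g * lift h" for g h
  proof (rule fls_eqI)
    fix n
    obtain a where a: "\<And>i. i < a \<Longrightarrow> g $$ i = 0" using fls_lower_bound_ex by blast
    obtain b where b: "\<And>i. i < b \<Longrightarrow> h $$ i = 0" using fls_lower_bound_ex by blast
    have "lift (g * h) $$ n = (\<Sum>i=a..n - b. V (g $$ i) * h $$ (n - i) + g $$ i * V (h $$ (n - i)))"
      by (simp add: fls_mult_nth_lower_bound[OF a b] sum mult)
    also have "\<dots> = (lift g * h + g * lift h) $$ n"
      using a b by (simp add: fls_mult_nth_lower_bound[of a _ b] sum.distrib)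
    finally show "lift (g * h) $$ n = (lift g * h + g * lift h) $$ n" .
  qed
qed

lemmas lift_add = derivation.add[OF derivation_lift]
  and lift_mult = derivation.mult[OF derivation_lift]
  and lift_diff = derivation.diff[OF derivation_lift]
  and lift_power2 = derivation.power2[OF derivation_lift]
  and lift_inverse = derivation.inverse[OF derivation_lift]

lemma lift_0 [simp]: "lift 0 = 0"
  by (rule fls_eqI) simp

lemma lift_const [simp]: "lift (fls_const a) = fls_const (V a)"
  by (rule fls_eqI) simp

lemma lift_zpow [simp]: "lift (zpow n) = 0"
  by (rule fls_eqI) (simp add: zpow_def)

lemma Res_lift: "Res (lift g) = V (Res g)"
  by (simp add: Res_def)

text \<open>The factors that \<open>zderiv\<close> puts in front of the coefficients are integers,
  hence constants of \<open>V\<close>.\<close>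

lemma lift_zderiv: "lift (zderiv g) = zderiv (lift g)"
proof (rule fls_eqI)
  fix n
  show "lift (zderiv g) $$ n = zderiv (lift g) $$ n"
    using zderiv_nth[of g "- n"] zderiv_nth[of "lift g" "- n"] by (simp add: mult diff)
qed

end

interpretation zderiv: derivation zderiv
proof
  show "zderiv (g + h) = zderiv g + zderiv h" for g h :: "'a fls"
    by (simp add: zderiv_def algebra_simps)
  show "zderiv (g * h) = zderiv g * h + g * zderiv h" for g h :: "'a fls"
    by (simp add: zderiv_def algebra_simps)
qed

lemma zderiv_nth': "zderiv g $$ n = of_int (1 - n) * g $$ (n - 1)"
  using zderiv_nth[of g "- n"] by simp

lemma Res_add: "Res (g + h) = Res g + Res h"
  and Res_diff: "Res (g - h) = Res g - Res h"
  and Res_0 [simp]: "Res 0 = 0"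
  for g h :: "'a::comm_ring_1 fls"
  by (simp_all add: Res_def)

lemma Res_sum: "Res (sum g A) = (\<Sum>i\<in>A. Res (g i))" for g :: "'i \<Rightarrow> 'a::comm_ring_1 fls"
  by (induction A rule: infinite_finite_induct) (simp_all add: Res_add)

lemma Res_const_mult: "Res (fls_const a * g) = a * Res g"
  and Res_mult_const: "Res (g * fls_const a) = Res g * a" for g :: "'a::comm_ring_1 fls"
  by (simp_all add: Res_def)

lemma Res_zderiv [simp]: "Res (zderiv g) = 0"
  by (simp add: Res_def zderiv_nth')

lemma Res_parts: "Res (zderiv g * h) = - Res (g * zderiv h)"
  using Res_zderiv[of "g * h"] unfolding zderiv.mult Res_add by (simp add: eq_neg_iff_add_eq_0)

lemma zpow_nth: "zpow n $$ i = (if i = - n then 1 else 0)"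
  by (simp add: zpow_def)

lemma zpow_mult_nth: "(zpow n * g) $$ i = g $$ (i + n)"
  using fls_X_intpow_times_conv_shift(1)[of "- n" g] by (simp add: zpow_def)

lemma zpow_add: "zpow (n + m) = zpow n * (zpow m :: 'a::comm_ring_1 fls)"
  by (rule fls_eqI) (simp only: zpow_mult_nth, auto simp: zpow_nth)

lemma zderiv_zpow: "zderiv (zpow n) = of_int n * zpow (n - 1)"
  by (rule fls_eqI) (auto simp: zderiv_nth' zpow_nth fls_of_int)

lemma zderiv_const [simp]: "zderiv (fls_const a) = 0"
  by (rule fls_eqI) (auto simp: zderiv_nth')

section \<open>Polynomials over a commutative ring\<close>

text \<open>The formal derivative over a ring that may have zero divisors, as the smooth functions
  on the configurations do.\<close>

definition pdiff :: "'a::comm_ring_1 poly \<Rightarrow> 'a poly" where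
  "pdiff p = Abs_poly (\<lambda>n. of_nat (Suc n) * poly.coeff p (Suc n))"

lemma coeff_pdiff: "poly.coeff (pdiff p) n = of_nat (Suc n) * poly.coeff p (Suc n)"
proof -
  have "\<forall>n>degree p. of_nat (Suc n) * poly.coeff p (Suc n) = 0"
    by (auto simp: coeff_eq_0)
  then show ?thesis
    unfolding pdiff_def by (subst coeff_Abs_poly) auto
qed

lemma pdiff_pCons: "pdiff (pCons a p) = p + pCons 0 (pdiff p)"
  by (rule poly_eqI) (auto simp: coeff_pdiff coeff_pCons algebra_simps split: nat.splits)

lemma pdiff_0 [simp]: "pdiff 0 = 0"
  by (rule poly_eqI) (simp add: coeff_pdiff)

lemma pdiff_add: "pdiff (p + q) = pdiff p + pdiff q"
  by (rule poly_eqI) (simp add: coeff_pdiff algebra_simps)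

lemma pdiff_diff: "pdiff (p - q) = pdiff p - pdiff q"
  by (rule poly_eqI) (simp add: coeff_pdiff algebra_simps)

lemma pdiff_smult: "pdiff (smult a p) = smult a (pdiff p)"
  by (rule poly_eqI) (simp add: coeff_pdiff algebra_simps)

lemma pdiff_mult: "pdiff (p * q) = pdiff p * q + p * pdiff q"
  by (induction p) (simp_all add: pdiff_pCons pdiff_add pdiff_smult algebra_simps)

lemma pdiff_monom_Suc: "pdiff (monom a (Suc n)) = monom (of_nat (Suc n) * a) n"
  by (rule poly_eqI) (auto simp: coeff_pdiff)

context derivation
begin

definition mpoly :: "'a poly \<Rightarrow> 'a poly" where
  "mpoly = map_poly V"

lemma coeff_mpoly: "poly.coeff (mpoly p) n = V (poly.coeff p n)"
  by (simp add: mpoly_def coeff_map_poly)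

lemma mpoly_0 [simp]: "mpoly 0 = 0"
  by (simp add: mpoly_def)

lemma mpoly_pCons: "mpoly (pCons a p) = pCons (V a) (mpoly p)"
  by (rule poly_eqI) (simp add: coeff_mpoly coeff_pCons split: nat.splits)

lemma pdiff_mpoly: "pdiff (mpoly p) = mpoly (pdiff p)"
  by (rule poly_eqI) (simp add: coeff_pdiff coeff_mpoly mult add)

text \<open>Both the coefficients and the argument move under \<open>V\<close>; each contributes one
  term.\<close>

lemma poly_eval: "V (poly p x) = poly (mpoly p) x + poly (pdiff p) x * V x"
  by (induction p) (simp_all add: mpoly_pCons pdiff_pCons add mult algebra_simps)

end

definition ev :: "'a::comm_ring_1 poly \<Rightarrow> 'a fls \<Rightarrow> 'a fls" where
  "ev p g = poly (map_poly fls_const p) g"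

lemma ev_0 [simp]: "ev 0 g = 0"
  by (simp add: ev_def)

lemma ev_pCons: "ev (pCons a p) g = fls_const a + g * ev p g"
  by (simp add: ev_def map_poly_pCons)

lemma fls_const_plus: "fls_const (a + b) = fls_const a + fls_const b" for a :: "'a::comm_ring_1"
  by (rule fls_eqI) simp

lemma ev_add: "ev (p + q) g = ev p g + ev q g"
  by (induction p q rule: poly_induct2)
     (simp_all add: ev_pCons fls_const_plus algebra_simps)

lemma ev_smult: "ev (smult a p) g = fls_const a * ev p g"
  by (induction p) (simp_all add: ev_pCons algebra_simps)

lemma ev_smult_of_int: "ev (smult (of_int k) p) g = of_int k * ev p g"
  by (simp only: ev_smult fls_of_int)

lemma ev_uminus: "ev (- p) g = - ev p g"
  using ev_add[of p "- p" g] by (simp add: eq_neg_iff_add_eq_0 add.commute)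

lemma ev_diff: "ev (p - q) g = ev p g - ev q g"
  using ev_add[of p "- q" g] by (simp add: ev_uminus)

lemma ev_mult: "ev (p * q) g = ev p g * ev q g"
  by (induction p) (simp_all add: ev_pCons ev_add ev_smult algebra_simps)

lemma ev_monom: "ev (monom a n) g = fls_const a * g ^ n"
  by (induction n) (simp_all add: ev_pCons monom_0 monom_Suc)

lemma ev_sum: "ev (sum p A) g = (\<Sum>i\<in>A. ev (p i) g)"
  by (induction A rule: infinite_finite_induct) (simp_all add: ev_add)

lemma ev_altdef: "ev p g = (\<Sum>i\<le>degree p. fls_const (poly.coeff p i) * g ^ i)"
  by (subst (1) poly_as_sum_of_monoms[of p, symmetric]) (simp add: ev_sum ev_monom)

lemma (in derivation) lift_ev: "lift (ev p g) = ev (mpoly p) g + ev (pdiff p) g * lift g"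
  by (induction p)
     (simp_all add: ev_pCons mpoly_pCons pdiff_pCons ev_add lift_add lift_mult algebra_simps)

lemma zderiv_ev: "zderiv (ev p g) = ev (pdiff p) g * zderiv g"
  by (induction p) (simp_all add: ev_pCons pdiff_pCons ev_add zderiv.add zderiv.mult algebra_simps)

lemma zinv_nth_le:
  fixes g :: "'a::comm_ring_1 fls"
  assumes "g $$ k = 1" "\<And>i. i < k \<Longrightarrow> g $$ i = 0"
  shows "g * zinv g = 1" and "i < - k \<Longrightarrow> zinv g $$ i = 0" and "zinv g $$ (- k) = 1"
proof -
  have sub: "fls_subdegree g = k"
    using assms by (intro fls_subdegree_eqI) auto
  then show inv: "g * zinv g = 1"
    using assms(1) by (intro zinv_works) simp
  show low: "zinv g $$ i = 0" if "i < - k" for i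
    using that sub by (simp add: zinv_def)
  have "(g * zinv g) $$ 0 = g $$ k * zinv g $$ (- k)"
    using assms(2) low by (intro fls_mult_nth_lead) auto
  with inv assms(1) show "zinv g $$ (- k) = 1" by simp
qed

section \<open>A normalized series and its Schwarzian\<close>

text \<open>Index \<open>j\<close> is the coefficient of \<open>z^(-j)\<close>, so
  \<open>f = z + O(1/z)\<close>. Absence of integer torsion stands in for division by integers; the
  zero constant term keeps every coefficient of index at most 0 fixed under derivations.\<close>

locale monic_series =
  fixes f :: "'a::comm_ring_1 fls"
  assumes torsion_free: "of_int k * (x::'a) = 0 \<Longrightarrow> k = 0 \<or> x = 0"
    and f_lead: "f $$ (-1) = 1"
    and f_0: "f $$ 0 = 0"
    and f_below: "i < -1 \<Longrightarrow> f $$ i = 0"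
begin

definition "\<phi> = zderiv f"
definition "\<psi> = zinv \<phi>"
definition "g = zinv f"

lemma \<phi>_below: "i < 0 \<Longrightarrow> \<phi> $$ i = 0" and \<phi>_lead: "\<phi> $$ 0 = 1"
  by (simp_all add: \<phi>_def zderiv_nth' f_below f_lead)

lemma \<psi>_below: "i < 0 \<Longrightarrow> \<psi> $$ i = 0" and \<phi>_\<psi>: "\<phi> * \<psi> = 1"
  using zinv_nth_le[of \<phi> 0] \<phi>_below \<phi>_lead unfolding \<psi>_def by simp_all

lemma g_below: "i < 1 \<Longrightarrow> g $$ i = 0" and g_lead: "g $$ 1 = 1" and f_g: "f * g = 1"
  using zinv_nth_le[of f "-1"] f_below f_lead unfolding g_def by simp_all

section \<open>Integer powers of the series\<close>

definition fpow :: "int \<Rightarrow> 'a fls" where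
  "fpow k = (if k \<ge> 0 then f ^ nat k else g ^ nat (- k))"

lemma fpow_0 [simp]: "fpow 0 = 1"
  by (simp add: fpow_def)

lemma fpow_of_nat: "fpow (int n) = f ^ n"
  by (simp add: fpow_def)

lemma fpow_neg: "fpow (- int n) = g ^ n"
  by (simp add: fpow_def)

lemma fpow_plus1: "fpow (k + 1) = f * fpow k"
proof (cases "k \<ge> 0")
  case True
  then show ?thesis by (simp add: fpow_def nat_add_distrib)
next
  case False
  then have "nat (- k) = Suc (nat (- (k + 1)))" by simp
  then have "f * fpow k = (f * g) * g ^ nat (- (k + 1))"
    using False by (simp add: fpow_def)
  then show ?thesis using False by (auto simp: f_g fpow_def)
qed

lemma fpow_minus1: "fpow (k - 1) = g * fpow k"
proof -
  have "g * fpow k = (f * g) * fpow (k - 1)"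
    using fpow_plus1[of "k - 1"] by (simp add: mult_ac)
  then show ?thesis by (simp add: f_g)
qed

lemma fpow_add: "fpow (k + l) = fpow k * fpow l"
proof (induction k rule: int_induct[where k = 0])
  case (step1 i)
  have "fpow (i + 1 + l) = fpow (i + l + 1)" by (simp add: algebra_simps)
  with step1 show ?case by (simp only: fpow_plus1) (simp add: mult_ac)
next
  case (step2 i)
  have "fpow (i - 1 + l) = fpow (i + l - 1)" by (simp add: algebra_simps)
  with step2 show ?case by (simp only: fpow_minus1) (simp add: mult_ac)
qed simp

lemma fpow_below_lead: "(\<forall>i < - k. fpow k $$ i = 0) \<and> fpow k $$ (- k) = 1"
proof (induction k rule: int_induct[where k = 0])
  case (step1 k)
  have "fpow (k + 1) $$ i = 0" if "i < - (k + 1)" for i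
    unfolding fpow_plus1 using step1 f_below that
    by (intro fls_mult_nth_below[where a = "-1" and b = "-k"]) auto
  moreover have "fpow (k + 1) $$ (- (k + 1)) = f $$ (-1) * fpow k $$ (- k)"
    unfolding fpow_plus1 using step1 f_below by (intro fls_mult_nth_lead) auto
  ultimately show ?case using step1 f_lead by simp
next
  case (step2 k)
  have "fpow (k - 1) $$ i = 0" if "i < - (k - 1)" for i
    unfolding fpow_minus1 using step2 g_below that
    by (intro fls_mult_nth_below[where a = "1" and b = "-k"]) auto
  moreover have "fpow (k - 1) $$ (- (k - 1)) = g $$ 1 * fpow k $$ (- k)"
    unfolding fpow_minus1 using step2 g_below by (intro fls_mult_nth_lead) auto
  ultimately show ?case using step2 g_lead by simp
qed simp

lemma fpow_below: "i < - k \<Longrightarrow> fpow k $$ i = 0" and fpow_lead: "fpow k $$ (- k) = 1"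
  using fpow_below_lead by auto

lemma zderiv_g: "zderiv g = - (g ^ 2 * \<phi>)"
  unfolding \<phi>_def by (rule zderiv.inverse) (simp add: f_g)

lemma zderiv_fpow: "zderiv (fpow k) = of_int k * fpow (k - 1) * \<phi>"
proof (induction k rule: int_induct[where k = 0])
  case (step1 k)
  have "zderiv (fpow (k + 1)) = \<phi> * fpow k + f * zderiv (fpow k)"
    by (simp add: fpow_plus1 zderiv.mult \<phi>_def)
  also have "f * zderiv (fpow k) = of_int k * fpow (k - 1 + 1) * \<phi>"
    unfolding step1 fpow_plus1 by (simp add: mult_ac)
  finally show ?case by (simp add: algebra_simps)
next
  case (step2 k)
  have "zderiv (fpow (k - 1)) = zderiv g * fpow k + g * zderiv (fpow k)"
    by (simp add: fpow_minus1 zderiv.mult)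
  also have "zderiv g * fpow k = - (g * fpow (k - 1) * \<phi>)"
    by (simp add: fpow_minus1 zderiv_g power2_eq_square mult_ac)
  also have "g * zderiv (fpow k) = of_int k * (g * fpow (k - 1) * \<phi>)"
    by (simp add: step2 mult_ac)
  also have "g * fpow (k - 1) = fpow (k - 1 - 1)"
    by (simp only: fpow_minus1)
  finally show ?case by (simp add: algebra_simps)
qed simp

text \<open>Away from \<open>k = -1\<close> the series is \<open>1 / (k + 1)\<close> times a
  derivative, torsion freeness replacing the division; for \<open>k = -1\<close> it is
  \<open>f' / f = 1/z + ...\<close>.\<close>

lemma Res_fpow: "Res (\<phi> * fpow k) = (if k = -1 then 1 else 0)"
proof (cases "k = -1")
  case True
  have "(\<phi> * fpow (-1)) $$ 1 = \<phi> $$ 0 * fpow (-1) $$ 1"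
    using \<phi>_below fpow_below[of _ "-1"] by (intro fls_mult_nth_lead) auto
  with True show ?thesis using fpow_lead[of "-1"] by (simp add: Res_def \<phi>_lead)
next
  case False
  have "of_int (k + 1) * Res (\<phi> * fpow k) = Res (zderiv (fpow (k + 1)))"
    by (simp only: zderiv_fpow fls_of_int Res_const_mult mult.assoc) (simp add: mult_ac)
  with False torsion_free[of "k + 1" "Res (\<phi> * fpow k)"] show ?thesis by auto
qed

text \<open>The powers of \<open>f\<close> form a topological basis of the Laurent series; the coefficients are
  residues because \<open>fpow k\<close> and \<open>\<phi> * fpow (- 1 - l)\<close> are dual under \<open>Res\<close>.\<close>

lemma expansion:
  assumes G: "\<And>i. i < - A \<Longrightarrow> G $$ i = 0" and j: "j \<le> K"
  shows "G $$ j = (\<Sum>k=-K..A. Res (\<phi> * fpow (- 1 - k) * G) * fpow k $$ j)"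
proof -
  define r where "r k = Res (\<phi> * fpow (- 1 - k) * G)" for k
  define H where "H = G - (\<Sum>k=-K..A. fls_const (r k) * fpow k)"
  have "H $$ i = 0" if "i \<le> K" for i
  proof (rule ccontr)
    assume nz: "H $$ i \<noteq> 0"
    \<comment> \<open>Let \<open>i0\<close> be the lowest index of the remainder \<open>H\<close>.
      Pairing \<open>H\<close> with \<open>\<phi> * fpow (- 1 + i0)\<close> reads off
      \<open>H $$ i0\<close>, yet duality makes the pairing vanish because the term
      \<open>k = - i0\<close> has been subtracted.\<close>
    define i0 where "i0 = fls_subdegree H"
    have H: "H \<noteq> 0" using nz by auto
    have i0: "H $$ i0 \<noteq> 0" "\<And>i. i < i0 \<Longrightarrow> H $$ i = 0"
      unfolding i0_def using H by auto
    then have "i0 \<le> K" using nz that by (metis not_less order_trans)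
    have "H $$ i = 0" if "i < - A" for i
      using that by (auto simp: H_def fls_nth_sum G fpow_below intro!: sum.neutral)
    then have "- A \<le> i0" using i0 by force
    have "(\<phi> * fpow (- 1 + i0)) $$ i = 0" if "i < 1 - i0" for i
      using that \<phi>_below fpow_below[of _ "-1 + i0"]
      by (intro fls_mult_nth_below[where a = 0 and b = "1 - i0"]) auto
    moreover have "(\<phi> * fpow (- 1 + i0)) $$ (1 - i0) = \<phi> $$ 0 * fpow (- 1 + i0) $$ (1 - i0)"
      using \<phi>_below fpow_below[of _ "-1 + i0"] by (intro fls_mult_nth_lead) auto
    moreover note fpow_lead[of "-1 + i0"]
    ultimately have "Res (\<phi> * fpow (- 1 + i0) * H) = H $$ i0"
      unfolding Res_def using i0 \<phi>_lead
      by (subst fls_mult_nth_lead[where a = "1 - i0" and b = i0]) auto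
    moreover have "Res (\<phi> * fpow (- 1 + i0) * H) =
        r (- i0) - (\<Sum>k=-K..A. r k * Res (\<phi> * fpow (- 1 + i0) * fpow k))"
    proof -
      have "\<phi> * fpow (- 1 + i0) * H = \<phi> * fpow (- 1 + i0) * G
          - (\<Sum>k=-K..A. fls_const (r k) * (\<phi> * fpow (- 1 + i0) * fpow k))"
        by (simp add: H_def right_diff_distrib sum_distrib_left mult_ac)
      then show ?thesis
        by (simp only: Res_diff Res_sum Res_const_mult) (simp add: r_def)
    qed
    moreover have "Res (\<phi> * fpow (- 1 + i0) * fpow k) = (if k = - i0 then 1 else 0)" for k
      using Res_fpow[of "-1 + i0 + k"] by (auto simp: fpow_add mult_ac)
    moreover have "(\<Sum>k=-K..A. r k * (if k = - i0 then 1 else 0)) = r (- i0)"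
      using \<open>i0 \<le> K\<close> \<open>- A \<le> i0\<close> by (simp add: if_distrib sum.delta cong: if_cong)
    ultimately show False
      using i0(1) by simp
  qed
  then show ?thesis
    using j by (simp add: H_def r_def fls_nth_sum)
qed

section \<open>The vector fields \<open>z^(1-n) d/dz\<close> and the polynomials
  \<open>pp n\<close>\<close>

definition G :: "int \<Rightarrow> 'a fls" where
  "G n = zpow (1 - n) * \<phi>"

lemma G_below: "i < n - 1 \<Longrightarrow> G n $$ i = 0"
  by (simp add: G_def zpow_mult_nth \<phi>_below)

text \<open>\<open>pp n\<close> is the part of the expansion of \<open>G n\<close> with nonnegative powers of \<open>f\<close>;
  its degree is at most \<open>1 - n\<close>.\<close>

definition pp :: "int \<Rightarrow> 'a poly" where
  "pp n = (\<Sum>k<nat (2 - n). monom (Res (\<phi> * g ^ Suc k * G n)) k)"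

text \<open>The truncation in \<open>pp\<close> loses nothing: for \<open>k\<close> at least
  \<open>2 - n\<close> the series \<open>g ^ Suc k * G n\<close> starts at index
  \<open>k + n\<close>, at least 2, and has no residue against \<open>\<phi>\<close>.\<close>

lemma coeff_pp: "poly.coeff (pp n) k = Res (\<phi> * g ^ Suc k * G n)"
proof (cases "k < nat (2 - n)")
  case True
  then show ?thesis by (simp add: pp_def coeff_sum if_distrib sum.delta cong: if_cong)
next
  case False
  have "(fpow (- int (Suc k)) * G n) $$ i = 0" if "i < int k + n" for i
    using that G_below[of _ n]
    by (intro fls_mult_nth_below[where a = "int (Suc k)" and b = "n - 1"] fpow_below) auto
  with False \<phi>_below have "(\<phi> * (fpow (- int (Suc k)) * G n)) $$ 1 = 0"
    by - (rule fls_mult_nth_below[where a = 0 and b = "int k + n"], simp_all del: of_nat_Suc)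
  then have "Res (\<phi> * g ^ Suc k * G n) = 0"
    by (simp only: fpow_neg Res_def mult.assoc)
  with False show ?thesis by (simp add: pp_def coeff_sum)
qed

text \<open>What remains of the expansion of \<open>G n\<close> are the powers
  \<open>f^(-1-m)\<close>, and those with \<open>m\<close> at least \<open>K\<close> start beyond
  index \<open>K\<close>. In this form the coefficients can be matched with those of the derivatives
  in the \<open>f_l\<close>.\<close>

lemma ev_pp_minus_G:
  assumes "j \<le> int K"
  shows "(ev (pp n) f - G n) $$ j =
    - (\<Sum>m<K. (g ^ Suc m) $$ j * Res (zpow (1 - n) * (\<phi> ^ 2 * f ^ m)))"
proof -
  define t where "t k = Res (\<phi> * fpow (- 1 - k) * G n) * fpow k $$ j" for k
  \<comment> \<open>\<open>A - 1\<close> bounds the powers of \<open>f\<close> in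
    \<open>G n\<close>; the maximum with 0 keeps it at least -1, so that the range splits at
    0.\<close>
  define A where "A = max 0 (2 - n)"
  have eq1: "G n $$ j = (\<Sum>k=-int K..A - 1. t k)"
    unfolding t_def using assms G_below[of _ n] by (intro expansion) (auto simp: A_def)
  also have "{-int K..A - 1} = {-int K..-1} \<union> {0..A - 1}"
    by (auto simp: A_def)
  also have "sum t \<dots> = (\<Sum>k=-int K..-1. t k) + (\<Sum>k=0..A - 1. t k)"
    by (rule sum.union_disjoint) auto
  also have "(\<Sum>k=0..A - 1. t k) = (\<Sum>m<nat (2 - n). t (int m))"
    by (rule sum.reindex_bij_witness[of _ int nat]) (auto simp: A_def)
  also have "\<dots> = ev (pp n) f $$ j"
  proof -
    have "fpow (- 1 - int m) = g ^ Suc m" for m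
      using fpow_neg[of "Suc m"] by (simp add: algebra_simps)
    then show ?thesis
      by (simp add: pp_def ev_sum ev_monom fls_nth_sum t_def fpow_of_nat)
  qed
  also have "(\<Sum>k=-int K..-1. t k) = (\<Sum>m<K. t (- int (Suc m)))"
    by (rule sum.reindex_bij_witness[of _ "\<lambda>m. - int (Suc m)" "\<lambda>k. nat (- 1 - k)"]) auto
  also have "\<dots> = (\<Sum>m<K. (g ^ Suc m) $$ j * Res (zpow (1 - n) * (\<phi> ^ 2 * f ^ m)))"
  proof (rule sum.cong[OF refl])
    fix m
    have "fpow (- 1 - (- int (Suc m))) = f ^ m"
      using fpow_of_nat[of m] by simp
    then show "t (- int (Suc m)) = (g ^ Suc m) $$ j * Res (zpow (1 - n) * (\<phi> ^ 2 * f ^ m))"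
      unfolding t_def by (simp only: fpow_neg G_def) (simp add: power2_eq_square mult_ac)
  qed
  finally show ?thesis by simp
qed

lemma ev_pp_minus_G_nonpos: "j \<le> 0 \<Longrightarrow> (ev (pp n) f - G n) $$ j = 0"
  using ev_pp_minus_G[of j 0 n] by simp

text \<open>The leading term of \<open>p(f)\<close> is \<open>lead_coeff p\<close> times
  \<open>z^(degree p)\<close>, which sits at an index at most 0. This makes \<open>pp n\<close>
  unique.\<close>

lemma ev_eq_0:
  assumes "\<And>j. j \<le> 0 \<Longrightarrow> ev p f $$ j = 0"
  shows "p = 0"
proof (rule ccontr)
  assume "p \<noteq> 0"
  have "(f ^ i) $$ (- int (degree p)) = (if i = degree p then 1 else 0)" if "i \<le> degree p" for i
    using fpow_below[of "- int (degree p)" "int i"] fpow_lead[of "int i"] that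
    by (auto simp: fpow_of_nat)
  then have "ev p f $$ (- int (degree p)) =
      (\<Sum>i\<le>degree p. poly.coeff p i * (if i = degree p then 1 else 0))"
    by (simp add: ev_altdef fls_nth_sum)
  then have "ev p f $$ (- int (degree p)) = lead_coeff p"
    by (simp add: if_distrib sum.delta cong: if_cong)
  with assms \<open>p \<noteq> 0\<close> show False by simp
qed

section \<open>The residue pairing \<open>B\<close>\<close>

definition D :: "'a fls \<Rightarrow> 'a fls" where
  "D X = \<psi> * zderiv X"

definition B :: "'a fls \<Rightarrow> 'a fls \<Rightarrow> 'a" where
  "B X Y = Res (\<phi> * (X * D (D (D Y))))"

lemma \<phi>_D: "\<phi> * D X = zderiv X"
  using \<phi>_\<psi> by (simp add: D_def flip: mult.assoc)

lemma B_diff: "B (X - Y) Z = B X Z - B Y Z" "B X (Y - Z) = B X Y - B X Z"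
  by (simp_all add: B_def D_def zderiv.diff algebra_simps Res_diff)

text \<open>Three integrations by parts move \<open>D^3\<close> to the other factor with sign -1;
  the proof writes out a primitive of the sum of both integrands.\<close>

lemma B_antisym: "B X Y = - B Y X"
proof -
  have "\<phi> * (X * D (D (D Y))) + \<phi> * (Y * D (D (D X))) =
      zderiv (X * D (D Y) - D X * D Y + D (D X) * Y)"
    unfolding zderiv.mult zderiv.add zderiv.diff by (simp flip: \<phi>_D add: algebra_simps)
  from arg_cong[OF this, of Res] show ?thesis
    by (simp add: B_def Res_add eq_neg_iff_add_eq_0)
qed

lemma \<phi>_\<psi>': "\<phi> * (\<psi> * X) = X"
  by (simp add: \<phi>_\<psi> flip: mult.assoc)

lemma D_ev: "D (ev p f) = ev (pdiff p) f"
  by (simp add: D_def zderiv_ev mult_ac \<phi>_\<psi>' flip: \<phi>_def)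

lemma Res_ev: "Res (\<phi> * ev p f) = 0"
proof -
  have "Res (\<phi> * f ^ i) = 0" for i
    using Res_fpow[of "int i"] by (simp add: fpow_of_nat)
  moreover have "\<phi> * ev p f = (\<Sum>i\<le>degree p. fls_const (poly.coeff p i) * (\<phi> * f ^ i))"
    by (simp add: ev_altdef sum_distrib_left mult_ac)
  ultimately show ?thesis by (simp add: Res_sum Res_const_mult)
qed

text \<open>\<open>D\<close> and multiplication preserve polynomials in \<open>f\<close>, and
  \<open>\<phi>\<close> times such a polynomial has no residue.\<close>

lemma B_ev: "B (ev p f) (ev q f) = 0"
  by (simp add: B_def D_ev Res_ev flip: ev_mult)

text \<open>Both arguments are \<open>O(1/z)\<close> and \<open>D\<close> preserves this, so the
  integrand is \<open>O(1/z^2)\<close>.\<close>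

lemma B_negative:
  assumes "\<And>j. j \<le> 0 \<Longrightarrow> X $$ j = 0" "\<And>j. j \<le> 0 \<Longrightarrow> Y $$ j = 0"
  shows "B X Y = 0"
proof -
  have D: "D Z $$ j = 0" if "\<And>j. j \<le> 0 \<Longrightarrow> Z $$ j = 0" "j \<le> 0" for Z j
    unfolding D_def using \<psi>_below that
    by (intro fls_mult_nth_below[where a = 0 and b = 1]) (auto simp: zderiv_nth')
  have "(X * D (D (D Y))) $$ j = 0" if "j \<le> 1" for j
    using assms that by (intro fls_mult_nth_below[where a = 1 and b = 1] D) auto
  then have "(\<phi> * (X * D (D (D Y)))) $$ 1 = 0"
    using \<phi>_below by - (rule fls_mult_nth_below[where a = 0 and b = 2], auto)
  then show ?thesis by (simp add: B_def Res_def)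
qed

lemma zderiv_\<psi>: "zderiv \<psi> = - (\<psi> ^ 2 * zderiv \<phi>)"
  by (rule zderiv.inverse) (rule \<phi>_\<psi>)

text \<open>\<open>f'' / f'\<close>, in terms of which the Schwarzian is
  \<open>a' - a^2 / 2\<close>.\<close>

definition "a = zderiv \<phi> * \<psi>"

text \<open>\<open>Q X\<close> is $f'^2 (f'^{-1} \partial)^3 X$.\<close>

definition Q :: "'a fls \<Rightarrow> 'a fls" where
  "Q X = \<psi> * (zderiv (zderiv (zderiv X)) - 3 * a * zderiv (zderiv X)
     + (2 * a ^ 2 - zderiv a) * zderiv X)"

lemma zderiv_\<psi>': "zderiv \<psi> = - (a * \<psi>)"
  by (simp add: zderiv_\<psi> a_def power2_eq_square mult_ac)

lemma zderiv_\<phi>: "zderiv \<phi> = a * \<phi>"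
  by (simp add: a_def mult_ac \<phi>_\<psi>')

text \<open>Each \<open>D\<close> contributes a factor \<open>\<psi>\<close>, and
  \<open>\<psi>' = - a \<psi>\<close> turns the derivatives of these factors into expressions in
  \<open>a\<close>.\<close>

lemma Q_eq: "Q X = \<phi> ^ 2 * D (D (D X))"
proof -
  have "D (D (D X)) = \<psi> ^ 2 * Q X"
    unfolding D_def Q_def zderiv.mult zderiv_\<psi>' zderiv.add zderiv.uminus zderiv.diff
    by (simp add: algebra_simps power2_eq_square)
  then have "\<phi> ^ 2 * D (D (D X)) = (\<phi> * \<psi>) ^ 2 * Q X"
    by (simp add: power2_eq_square mult_ac)
  then show ?thesis by (simp add: \<phi>_\<psi>)
qed

text \<open>The factor \<open>\<phi>\<close> inside \<open>G m\<close> completes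
  \<open>\<phi> D^3\<close> to \<open>Q\<close>.\<close>

lemma B_G: "B (G m) X = Res (zpow (1 - m) * Q X)"
  by (simp add: B_def G_def Q_eq power2_eq_square mult_ac)

section \<open>The Schwarzian and its residues\<close>

context
  fixes h :: 'a
  assumes h: "2 * h = 1"
begin

text \<open>\<open>h\<close> plays one half in a ring that is not a field;
  \<open>a' = f''' / f' - a^2\<close> turns this into the usual coefficient 3/2.\<close>

definition sch :: "'a fls" where
  "sch = zderiv a - fls_const h * a ^ 2"

lemma h': "fls_const h * 2 = 1"
proof -
  have "fls_const h * 2 = fls_const (h * 2)"
    by (rule fls_eqI) (metis fls_const_mult_const fls_const_numeral)
  with h show ?thesis by (simp add: mult.commute)
qed

lemma twice_sch: "2 * sch = 2 * zderiv a - a ^ 2"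
  using arg_cong[OF h', of "\<lambda>x. x * a ^ 2"] by (simp add: sch_def algebra_simps)

lemma zderiv_sch: "zderiv sch = zderiv (zderiv a) - a * zderiv a"
proof -
  have "zderiv sch = zderiv (zderiv a) - (fls_const h * 2) * (a * zderiv a)"
    by (simp add: sch_def zderiv.diff zderiv.mult zderiv.power2 mult_ac)
  then show ?thesis by (simp add: h')
qed

text \<open>By \<open>\<phi>' = a \<phi>\<close> every term carries the factor
  \<open>\<phi> * \<psi> = 1\<close>. The terms in \<open>v''\<close> cancel, and the coefficients
  of \<open>v'\<close> and \<open>v\<close> assemble to twice the Schwarzian and its
  derivative.\<close>

lemma Q_mult_\<phi>: "Q (v * \<phi>) = zderiv (zderiv (zderiv v)) + 2 * zderiv v * sch + v * zderiv sch"
proof -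
  have "Q (v * \<phi>) = (\<phi> * \<psi>) *
      (zderiv (zderiv (zderiv v)) + zderiv v * (2 * zderiv a - a ^ 2)
        + v * (zderiv (zderiv a) - a * zderiv a))"
    unfolding Q_def zderiv.mult zderiv_\<phi> zderiv.add zderiv.uminus zderiv.diff
    by (simp add: algebra_simps power2_eq_square)
  then show ?thesis by (simp only: \<phi>_\<psi> zderiv_sch twice_sch[symmetric]) (simp add: mult_ac)
qed

definition "S n = Res (zpow (1 - n) * sch)"

text \<open>Evaluate \<open>Q_mult_\<phi>\<close> at \<open>v = z^(1-n)\<close> and pair with
  \<open>w = z^(1-m)\<close>: the Schwarzian terms give the bracket of two vector fields, the third
  derivative gives the central term.\<close>

lemma B_G_G: "B (G m) (G n) =
  - (of_int (n - m) * S (n + m) + (if n + m = 0 then of_int (n ^ 3 - n) else 0))"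
proof -
  define v where "v = (zpow (1 - n) :: 'a fls)"
  define w where "w = (zpow (1 - m) :: 'a fls)"
  have "B (G m) (G n) = Res (w * (zderiv (zderiv (zderiv v)) + 2 * zderiv v * sch + v * zderiv sch))"
    by (simp add: B_G Q_mult_\<phi> G_def[of n] v_def w_def)
  also have "w * (zderiv (zderiv (zderiv v)) + 2 * zderiv v * sch + v * zderiv sch) =
      w * zderiv (zderiv (zderiv v)) + (w * zderiv v * sch + w * zderiv v * sch + (w * v) * zderiv sch)"
    by (simp add: algebra_simps)
  \<comment> \<open>Integrating \<open>w v sch'\<close> by parts turns \<open>2 w v'\<close> into
    the bracket \<open>w v' - w' v\<close>.\<close>
  also have "Res \<dots> = Res (w * zderiv (zderiv (zderiv v))) + Res ((w * zderiv v - zderiv w * v) * sch)"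
    using Res_parts[of "w * v" sch]
    by (simp only: Res_add Res_diff zderiv.mult left_diff_distrib distrib_right)
       (simp add: algebra_simps)
  also have "w * zderiv v - zderiv w * v = fls_const (of_int (m - n)) * zpow (1 - (n + m))"
  proof -
    have eq: "w * zpow (1 - n - 1) = zpow (1 - (n + m))" "zpow (1 - m - 1) * v = zpow (1 - (n + m))"
      unfolding v_def w_def by (simp_all add: algebra_simps flip: zpow_add)
    have "w * zderiv v - zderiv w * v = of_int (1 - n) * (w * zpow (1 - n - 1))
        - of_int (1 - m) * (zpow (1 - m - 1) * v)"
      unfolding v_def w_def zderiv_zpow by (simp only: mult_ac)
    also have "\<dots> = (of_int (1 - n) - of_int (1 - m)) * zpow (1 - (n + m))"
      unfolding eq by (simp only: left_diff_distrib)
    also have "of_int (1 - n) - of_int (1 - m) = fls_const (of_int (m - n) :: 'a)"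
      by (simp only: fls_of_int[symmetric]) simp
    finally show ?thesis .
  qed
  also have "Res (w * zderiv (zderiv (zderiv v))) =
      - (if n + m = 0 then of_int (n ^ 3 - n) else 0)"
  proof -
    have "zderiv (zderiv (zderiv v)) =
        of_int ((1 - n) * ((1 - n - 1) * (1 - n - 1 - 1))) * zpow (1 - n - 1 - 1 - 1)"
    proof -
      have "zderiv (of_int k * X) = of_int k * zderiv X" for k and X :: "'a fls"
        by (simp add: zderiv.mult)
      then show ?thesis
        by (simp only: v_def zderiv_zpow of_int_mult mult.assoc)
    qed
    \<comment> \<open>Three derivatives of \<open>z^(1-n)\<close> produce the cubic polynomial of
      the central term; the remaining power \<open>z^(-1-(n+m))\<close> has a residue only for
      \<open>n + m = 0\<close>.\<close>
    also have "(1 - n) * ((1 - n - 1) * (1 - n - 1 - 1)) = - (n ^ 3 - n)"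
      by (simp add: algebra_simps power3_eq_cube)
    finally have "w * zderiv (zderiv (zderiv v)) =
        fls_const (of_int (- (n ^ 3 - n))) * (w * zpow (1 - n - 1 - 1 - 1))"
      by (simp only: fls_of_int mult_ac)
    also have "w * zpow (1 - n - 1 - 1 - 1) = zpow (- 1 - (n + m))"
      unfolding w_def by (simp add: algebra_simps flip: zpow_add)
    finally show ?thesis
      by (simp only: Res_const_mult) (simp add: Res_def zpow_nth)
  qed
  finally show ?thesis
    unfolding S_def by (simp only: Res_const_mult mult.assoc) (simp add: algebra_simps)
qed

end

end

section \<open>The flow on normalized series\<close>

text \<open>Derivations whose action on the series is a reparametrization by \<open>G n\<close>
  corrected by \<open>pp n\<close>. Marked points enter as ring elements \<open>x\<close> with
  \<open>V n x = poly (pp n) x\<close>.\<close>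

locale virasoro_flow = monic_series f for f :: "'a::comm_ring_1 fls" +
  fixes V :: "int \<Rightarrow> 'a \<Rightarrow> 'a" and h :: 'a
  assumes derivation: "derivation (V n)"
    and flow: "derivation.lift (V n) f = ev (pp n) f - G n"
    and h: "2 * h = 1"
begin

interpretation V: derivation "V n" for n
  by (rule derivation)

definition "X n = ev (pp n) f - G n"

lemma X_below: "j \<le> 0 \<Longrightarrow> X n $$ j = 0"
  unfolding X_def by (rule ev_pp_minus_G_nonpos)

lemma lift_\<phi>: "V.lift n \<phi> = zderiv (X n)"
  by (simp add: \<phi>_def V.lift_zderiv flow X_def)

lemma lift_\<psi>: "V.lift n \<psi> = - (\<psi> ^ 2 * zderiv (X n))"
  using V.lift_inverse[OF \<phi>_\<psi>] by (simp add: lift_\<phi>)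

lemma lift_a: "V.lift n a = \<psi> * (zderiv (zderiv (X n)) - a * zderiv (X n))"
  by (simp add: a_def V.lift_mult V.lift_zderiv lift_\<phi> lift_\<psi> power2_eq_square algebra_simps)

lemma V_h: "V n h = 0"
proof -
  have "of_int 2 * V n h = V n (2 * h)"
    by (simp add: V.mult)
  also have "\<dots> = 0" by (simp add: h)
  finally show ?thesis using torsion_free[of 2 "V n h"] by simp
qed

lemma lift_sch: "V.lift n (sch h) = Q (X n)"
proof -
  have "V.lift n (sch h) = zderiv (V.lift n a) - (fls_const h * 2) * (a * V.lift n a)"
    by (simp add: sch_def[OF h] V.lift_diff V.lift_mult V.lift_power2 V.lift_zderiv V_h mult_ac)
  also have "\<dots> = zderiv (V.lift n a) - a * V.lift n a"
    by (simp add: h'[OF h])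
  also have "\<dots> = Q (X n)"
    unfolding lift_a Q_def zderiv.mult zderiv.diff zderiv_\<psi>'
    by (simp add: algebra_simps power2_eq_square)
  finally show ?thesis .
qed

lemma V_S: "V n (S h m) = B (G m) (X n)"
  by (simp add: S_def[OF h] V.lift_mult lift_sch B_G flip: V.Res_lift)

text \<open>Split \<open>G = P - X\<close> into the polynomial and the negative part.
  \<open>B\<close> vanishes on two parts of the same kind, so both sides reduce to mixed terms,
  which antisymmetry matches.\<close>

lemma S_commutator:
  "V n (S h m) - V m (S h n) =
    of_int (n - m) * S h (n + m) + (if n + m = 0 then of_int (n ^ 3 - n) else 0)"
proof -
  define P where "P n = ev (pp n) f" for n
  have G: "G n = P n - X n" for n by (simp add: P_def X_def)
  have X: "B (X i) (X j) = 0" for i j by (rule B_negative) (auto simp: X_below)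
  have P: "B (P i) (P j) = 0" for i j by (simp add: P_def B_ev)
  have "V n (S h m) - V m (S h n) = B (P m) (X n) - B (P n) (X m)"
    by (simp add: V_S G B_diff X)
  also have "\<dots> = - B (G m) (G n)"
    using B_antisym[of "P n" "X m"] by (simp add: G B_diff X P)
  finally show ?thesis by (simp add: B_G_G[OF h])
qed

lemma lift_commutator_raw:
  "V.lift n (V.lift m f) - V.lift m (V.lift n f) =
    ev (V.mpoly n (pp m) - V.mpoly m (pp n) + pdiff (pp m) * pp n - pdiff (pp n) * pp m) f
      - of_int (n - m) * G (n + m)"
proof -
  have lift_G: "V.lift n (G m) = zpow (1 - m) * zderiv (X n)" for n m
    by (simp add: G_def V.lift_mult lift_\<phi>)
  \<comment> \<open>The bracket of \<open>z^(1-n) d/dz\<close> and \<open>z^(1-m) d/dz\<close>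
    applied to \<open>f\<close>; the terms in \<open>f''\<close> cancel.\<close>
  have z: "zpow (1 - m) * zderiv (G n) - zpow (1 - n) * zderiv (G m) =
      - (of_int (n - m) * G (n + m))"
  proof -
    have eq: "zpow (1 - m) * (zpow (1 - n - 1) :: 'a fls) = zpow (1 - (n + m))" for m n
      by (simp add: algebra_simps flip: zpow_add)
    have eq2: "zpow (1 - m) * zderiv (G n) = of_int (1 - n) * (zpow (1 - m) * zpow (1 - n - 1)) * \<phi>
        + zpow (1 - n) * zpow (1 - m) * zderiv \<phi>" for n m
      by (simp add: G_def zderiv.mult zderiv_zpow algebra_simps)
    have "zpow (1 - m) * zderiv (G n) - zpow (1 - n) * zderiv (G m) =
        (of_int (1 - n) * zpow (1 - (n + m)) - of_int (1 - m) * zpow (1 - (m + n))) * \<phi>"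
      using eq2[of m n] eq2[of n m] unfolding eq by (simp add: algebra_simps)
    then show ?thesis by (simp add: G_def algebra_simps)
  qed
  \<comment> \<open>The terms in parentheses are symmetric in \<open>n\<close> and \<open>m\<close>
    and drop out of the commutator.\<close>
  have eq3: "V.lift n (V.lift m f) = ev (V.mpoly n (pp m)) f + ev (pdiff (pp m) * pp n) f
      - (ev (pdiff (pp m)) f * zpow (1 - n) * \<phi> + zpow (1 - m) * ev (pdiff (pp n)) f * \<phi>)
      + zpow (1 - m) * zderiv (G n)" for n m
  proof -
    have "V.lift n (V.lift m f) = ev (V.mpoly n (pp m)) f + ev (pdiff (pp m)) f * X n
        - zpow (1 - m) * zderiv (X n)"
      by (simp add: flow[of m] V.lift_diff V.lift_ev lift_G) (simp add: flow X_def)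
    then show ?thesis
      by (simp add: X_def zderiv.diff zderiv_ev ev_mult G_def algebra_simps flip: \<phi>_def)
  qed
  have z': "of_int (n - m) * G (n + m) = zpow (1 - n) * zderiv (G m) - zpow (1 - m) * zderiv (G n)"
    using z by (metis minus_diff_eq minus_minus)
  show ?thesis
    unfolding z' eq3[of m n] eq3[of n m] by (simp add: ev_add ev_diff algebra_simps)
qed

text \<open>The coefficients of \<open>f\<close> of index at most 0 are 0 or 1, so the commutator on
  \<open>f\<close> lives in positive indices, as does \<open>X (n + m)\<close>. Hence the difference
  of both sides, evaluated at \<open>f\<close>, does too, and \<open>ev_eq_0\<close>
  applies.\<close>

lemma pp_commutator:
  "V.mpoly n (pp m) - V.mpoly m (pp n) + pdiff (pp m) * pp n - pdiff (pp n) * pp m =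
    smult (of_int (n - m)) (pp (n + m))" (is "?q = ?r")
proof -
  have V_f: "V n (f $$ j) = 0" if "j \<le> 0" for n j
    using f_lead f_0 f_below[of j] that by (cases "j = 0"; cases "j = -1") simp_all
  have "ev (?q - ?r) f = V.lift n (V.lift m f) - V.lift m (V.lift n f) - of_int (n - m) * X (n + m)"
    unfolding lift_commutator_raw ev_diff[of ?q ?r] ev_smult_of_int X_def by (simp add: algebra_simps)
  then have "ev (?q - ?r) f $$ j = 0" if "j \<le> 0" for j
    using that by (simp add: V_f X_below fls_of_int)
  then have "?q - ?r = 0" by (rule ev_eq_0)
  then show ?thesis by simp
qed

lemma lift_commutator:
  "V.lift n (V.lift m f) - V.lift m (V.lift n f) = of_int (n - m) * V.lift (n + m) f"
  unfolding lift_commutator_raw pp_commutator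
  by (simp only: flow ev_smult_of_int right_diff_distrib)

lemma V_commutator_nth:
  "V n (V m (f $$ j)) - V m (V n (f $$ j)) = of_int (n - m) * V (n + m) (f $$ j)"
  using arg_cong[OF lift_commutator[of n m], of "\<lambda>s. s $$ j"] by (simp add: fls_of_int)

text \<open>For a point dragged along by the polynomials, the chain rule makes the commutator the
  left-hand side of \<open>pp_commutator\<close> evaluated at \<open>x\<close>.\<close>

lemma point_commutator:
  assumes "\<And>k. V k x = poly (pp k) x"
  shows "V n (V m x) - V m (V n x) = of_int (n - m) * V (n + m) x"
proof -
  have "V n (V m x) - V m (V n x) = poly (V.mpoly n (pp m) - V.mpoly m (pp n)
      + pdiff (pp m) * pp n - pdiff (pp n) * pp m) x"
    unfolding assms V.poly_eval by simp
  then show ?thesis unfolding pp_commutator by (simp add: assms)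
qed

text \<open>The same with the derivative of \<open>pp_commutator\<close>, in which the products
  \<open>p_n' p_m'\<close> cancel. This is the cocycle identity for the weight terms.\<close>

lemma point_pdiff_commutator:
  assumes "\<And>k. V k x = poly (pp k) x"
  shows "V n (poly (pdiff (pp m)) x) - V m (poly (pdiff (pp n)) x) =
    of_int (n - m) * poly (pdiff (pp (n + m))) x"
proof -
  have "V n (poly (pdiff (pp m)) x) - V m (poly (pdiff (pp n)) x) =
      poly (pdiff (V.mpoly n (pp m) - V.mpoly m (pp n)
      + pdiff (pp m) * pp n - pdiff (pp n) * pp m)) x"
    unfolding V.poly_eval assms by (simp add: pdiff_add pdiff_diff pdiff_mult V.pdiff_mpoly)
  then show ?thesis unfolding pp_commutator by (simp add: pdiff_smult)
qed

end

section \<open>Vector fields\<close>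

text \<open>There may be infinitely many directions; since only finitely many act nontrivially on a
  given element, \<open>field a\<close> makes sense for arbitrary components
  \<open>a\<close>.\<close>

locale commuting_derivations =
  fixes d :: "'t \<Rightarrow> 'a::comm_ring_1 \<Rightarrow> 'a"
  assumes derivation: "derivation (d t)"
    and commute: "d s (d t P) = d t (d s P)"
    and finite_support: "finite {t. d t P \<noteq> 0}"
begin

interpretation d: derivation "d t" for t
  by (rule derivation)

definition field :: "('t \<Rightarrow> 'a) \<Rightarrow> 'a \<Rightarrow> 'a" where
  "field a P = (\<Sum>t | d t P \<noteq> 0. a t * d t P)"

lemma field_eq:
  assumes "finite T" "{t. d t P \<noteq> 0} \<subseteq> T"
  shows "field a P = (\<Sum>t\<in>T. a t * d t P)"
  unfolding field_def using assms by (intro sum.mono_neutral_left) auto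

lemma derivation_field: "derivation (field a)"
proof
  fix P Q
  define T where "T = {t. d t P \<noteq> 0} \<union> {t. d t Q \<noteq> 0}"
  have T: "finite T" by (simp add: T_def finite_support)
  have P: "field a P = (\<Sum>t\<in>T. a t * d t P)" and Q: "field a Q = (\<Sum>t\<in>T. a t * d t Q)"
    using T by (auto intro!: field_eq simp: T_def)
  have "field a (P + Q) = (\<Sum>t\<in>T. a t * d t (P + Q))"
    by (rule field_eq[OF T]) (auto simp: T_def d.add)
  then show "field a (P + Q) = field a P + field a Q"
    by (simp add: P Q d.add algebra_simps sum.distrib)
  have "field a (P * Q) = (\<Sum>t\<in>T. a t * d t (P * Q))"
    by (rule field_eq[OF T]) (auto simp: T_def d.mult)
  then show "field a (P * Q) = field a P * Q + P * field a Q"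
    by (simp add: P Q d.mult algebra_simps sum.distrib sum_distrib_left)
qed

text \<open>The second-order terms cancel because the directions commute, so a commutator of fields
  is again a field and is determined by its components.\<close>

lemma field_commutator:
  "field a (field b P) - field b (field a P) = field (\<lambda>t. field a (b t) - field b (a t)) P"
proof -
  \<comment> \<open>Directions acting on \<open>P\<close> or on its first derivatives, so that one
    index set serves both applications.\<close>
  define T where "T = {t. d t P \<noteq> 0} \<union> (\<Union>t\<in>{t. d t P \<noteq> 0}. {s. d s (d t P) \<noteq> 0})"
  have T: "finite T" by (auto simp: T_def finite_support)
  have P: "field b P = (\<Sum>t\<in>T. b t * d t P)" for b
    by (rule field_eq[OF T]) (auto simp: T_def)
  have dP: "field a (d t P) = (\<Sum>s\<in>T. a s * d s (d t P))" for a t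
  proof (rule field_eq[OF T], safe)
    fix s assume "d s (d t P) \<noteq> 0"
    then show "s \<in> T" by (cases "d t P = 0") (auto simp: T_def)
  qed
  have fld: "field a (field b P) = (\<Sum>t\<in>T. field a (b t) * d t P)
      + (\<Sum>t\<in>T. \<Sum>s\<in>T. b t * a s * d s (d t P))" for a b
  proof -
    interpret derivation "field a" by (rule derivation_field)
    show ?thesis
      unfolding P[of b] sum mult dP by (simp add: sum.distrib sum_distrib_left mult_ac)
  qed
  have "(\<Sum>t\<in>T. \<Sum>s\<in>T. b t * a s * d s (d t P)) = (\<Sum>t\<in>T. \<Sum>s\<in>T. a t * b s * d s (d t P))"
    by (subst sum.swap) (simp add: commute mult_ac)
  then show ?thesis
    unfolding fld P[of "\<lambda>t. field a (b t) - field b (a t)"]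
    by (simp add: sum_subtractf left_diff_distrib)
qed

end

section \<open>Symmetry of second derivatives\<close>

lemma has_real_derivative_along_line:
  assumes "(g has_derivative g') (at (q + s *\<^sub>R u + w))"
  shows "((\<lambda>s. g (q + s *\<^sub>R u + w)) has_real_derivative g' u) (at s)"
proof -
  have "((\<lambda>s. q + s *\<^sub>R u + w) has_derivative (\<lambda>r. r *\<^sub>R u)) (at s)"
    by (auto intro!: derivative_eq_intros)
  from has_derivative_compose[OF this assms]
  show ?thesis
    using linear_cmul[OF has_derivative_linear[OF assms]]
    by (auto simp: has_field_derivative_def mult_commute_abs)
qed

text \<open>The mean value theorem twice: along \<open>u\<close> for the difference in direction
  \<open>v\<close>, then along \<open>v\<close> for the first derivative.\<close>

lemma second_difference_mvt:
  fixes g :: "'a::real_normed_vector \<Rightarrow> real"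
  assumes g: "\<And>x. x \<in> S \<Longrightarrow> (g has_derivative g' x) (at x)"
    and A: "\<And>x. x \<in> S \<Longrightarrow> ((\<lambda>x. g' x u) has_derivative A x) (at x)"
    and h: "0 < h" and S: "\<And>s t. 0 \<le> s \<Longrightarrow> s \<le> h \<Longrightarrow> 0 \<le> t \<Longrightarrow> t \<le> h \<Longrightarrow> p + s *\<^sub>R u + t *\<^sub>R v \<in> S"
  obtains s t where "0 \<le> s" "s \<le> h" "0 \<le> t" "t \<le> h"
    "g (p + h *\<^sub>R u + h *\<^sub>R v) - g (p + h *\<^sub>R u) - g (p + h *\<^sub>R v) + g p
      = h * h * A (p + s *\<^sub>R u + t *\<^sub>R v) v"
proof -
  define \<Delta> where "\<Delta> s = g (p + s *\<^sub>R u + h *\<^sub>R v) - g (p + s *\<^sub>R u + 0 *\<^sub>R v)" for s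
  have "\<exists>s>0. s < h \<and> \<Delta> h - \<Delta> 0 =
      (h - 0) * (g' (p + s *\<^sub>R u + h *\<^sub>R v) u - g' (p + s *\<^sub>R u + 0 *\<^sub>R v) u)"
  proof (rule MVT2[OF h])
    fix s assume s: "0 \<le> s" "s \<le> h"
    have "((\<lambda>s. g (p + s *\<^sub>R u + t *\<^sub>R v)) has_real_derivative
        g' (p + s *\<^sub>R u + t *\<^sub>R v) u) (at s)" if "0 \<le> t" "t \<le> h" for t
      by (rule has_real_derivative_along_line[OF g[OF S[OF s that]]])
    from DERIV_diff[OF this[of h] this[of 0]]
    show "(\<Delta> has_real_derivative
        (g' (p + s *\<^sub>R u + h *\<^sub>R v) u - g' (p + s *\<^sub>R u + 0 *\<^sub>R v) u)) (at s)"
      unfolding \<Delta>_def using h by simp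
  qed
  then obtain s where s: "0 < s" "s < h" and \<Delta>: "\<Delta> h - \<Delta> 0 =
      h * (g' (p + s *\<^sub>R u + h *\<^sub>R v) u - g' (p + s *\<^sub>R u + 0 *\<^sub>R v) u)" by auto
  have "\<exists>t>0. t < h \<and> g' (p + s *\<^sub>R u + h *\<^sub>R v) u - g' (p + s *\<^sub>R u + 0 *\<^sub>R v) u
      = (h - 0) * A (p + s *\<^sub>R u + t *\<^sub>R v) v"
  proof (rule MVT2[OF h])
    fix t assume t: "0 \<le> t" "t \<le> h"
    then have inS: "p + s *\<^sub>R u + t *\<^sub>R v \<in> S" using s by (intro S) auto
    then show "((\<lambda>t. g' (p + s *\<^sub>R u + t *\<^sub>R v) u) has_real_derivative
        A (p + s *\<^sub>R u + t *\<^sub>R v) v) (at t)"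
      using has_real_derivative_along_line[of "\<lambda>x. g' x u" "A (p + s *\<^sub>R u + t *\<^sub>R v)" "p + s *\<^sub>R u" t v 0]
        A[OF inS] by simp
  qed
  then obtain t where "0 < t" "t < h" "g' (p + s *\<^sub>R u + h *\<^sub>R v) u - g' (p + s *\<^sub>R u + 0 *\<^sub>R v) u
      = h * A (p + s *\<^sub>R u + t *\<^sub>R v) v" by auto
  with s \<Delta> show thesis
    by (intro that[of s t]) (auto simp: \<Delta>_def)
qed

text \<open>Schwarz's theorem. The second difference over a small parallelogram is symmetric in
  \<open>u\<close> and \<open>v\<close>, so some value of one mixed derivative near \<open>p\<close>
  equals some value of the other, and continuity carries this to \<open>p\<close>.\<close>

lemma second_derivative_symmetric_real:
  fixes g :: "'a::real_normed_vector \<Rightarrow> real"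
  assumes "open S" "p \<in> S"
    and g: "\<And>x. x \<in> S \<Longrightarrow> (g has_derivative g' x) (at x)"
    and A: "\<And>x. x \<in> S \<Longrightarrow> ((\<lambda>x. g' x u) has_derivative A x) (at x)"
    and B: "\<And>x. x \<in> S \<Longrightarrow> ((\<lambda>x. g' x v) has_derivative B x) (at x)"
    and contA: "continuous_on S (\<lambda>x. A x v)" and contB: "continuous_on S (\<lambda>x. B x u)"
  shows "A p v = B p u"
proof (rule ccontr)
  assume ne: "A p v \<noteq> B p u"
  \<comment> \<open>Half the gap: values within less than \<open>e\<close> of the two sides cannot
    coincide.\<close>
  define e where "e = \<bar>A p v - B p u\<bar> / 2"
  have e: "e > 0" using ne by (simp add: e_def)
  have near: "\<forall>\<^sub>F x in nhds p. x \<in> S \<and> dist (A x v) (A p v) < e \<and> dist (B x u) (B p u) < e"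
  proof (intro eventually_conj)
    show "\<forall>\<^sub>F x in nhds p. x \<in> S"
      using assms(1,2) by (rule eventually_nhds_in_open)
    have "isCont (\<lambda>x. A x v) p" "isCont (\<lambda>x. B x u) p"
      using contA contB assms(1,2) by (auto simp: continuous_on_eq_continuous_at)
    then have "((\<lambda>x. A x v) \<longlongrightarrow> A p v) (nhds p)" "((\<lambda>x. B x u) \<longlongrightarrow> B p u) (nhds p)"
      using tendsto_at_iff_tendsto_nhds[of "\<lambda>x. A x v" p] tendsto_at_iff_tendsto_nhds[of "\<lambda>x. B x u" p]
      by (simp_all add: isCont_def)
    from this[THEN tendstoD, OF e]
    show "\<forall>\<^sub>F x in nhds p. dist (A x v) (A p v) < e" "\<forall>\<^sub>F x in nhds p. dist (B x u) (B p u) < e" .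
  qed
  then obtain r where r: "r > 0" and ball: "\<And>x. dist x p < r \<Longrightarrow>
      x \<in> S \<and> dist (A x v) (A p v) < e \<and> dist (B x u) (B p u) < e"
    by (auto simp: eventually_nhds_metric)
  \<comment> \<open>This choice of \<open>k\<close> and \<open>h\<close> puts the whole
    parallelogram within \<open>r / 2\<close> of \<open>p\<close>; the summand 1 makes
    \<open>k\<close> positive.\<close>
  define k where "k = norm u + norm v + 1"
  define h where "h = r / (2 * k)"
  have pos: "k > 0" unfolding k_def by (smt (verit) norm_ge_zero)
  then have h: "h > 0" using r by (simp add: h_def)
  have near': "dist (p + s *\<^sub>R u + t *\<^sub>R v) p < r" if "0 \<le> s" "s \<le> h" "0 \<le> t" "t \<le> h" for s t
  proof -
    have "dist (p + s *\<^sub>R u + t *\<^sub>R v) p \<le> norm (s *\<^sub>R u) + norm (t *\<^sub>R v)"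
      using norm_triangle_ineq[of "s *\<^sub>R u" "t *\<^sub>R v"] by (simp add: dist_norm add.assoc)
    also have "\<dots> \<le> h * norm u + h * norm v"
      using that by (simp add: add_mono mult_right_mono)
    also have "\<dots> \<le> h * k"
      using h by (simp add: k_def algebra_simps)
    also have "\<dots> = r / 2" using pos by (simp add: h_def)
    also have "\<dots> < r" using r by simp
    finally show ?thesis .
  qed
  obtain s t where st: "0 \<le> s" "s \<le> h" "0 \<le> t" "t \<le> h" and eq1:
      "g (p + h *\<^sub>R u + h *\<^sub>R v) - g (p + h *\<^sub>R u) - g (p + h *\<^sub>R v) + g p
        = h * h * A (p + s *\<^sub>R u + t *\<^sub>R v) v"
  proof (rule second_difference_mvt[of S g g' u A h p v])
    show "p + s *\<^sub>R u + t *\<^sub>R v \<in> S" if "0 \<le> s" "s \<le> h" "0 \<le> t" "t \<le> h" for s t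
      using ball[OF near'[OF that]] by simp
  qed (use g A h in auto)
  obtain s' t' where st': "0 \<le> s'" "s' \<le> h" "0 \<le> t'" "t' \<le> h" and eq2:
      "g (p + h *\<^sub>R v + h *\<^sub>R u) - g (p + h *\<^sub>R v) - g (p + h *\<^sub>R u) + g p
        = h * h * B (p + s' *\<^sub>R v + t' *\<^sub>R u) u"
  proof (rule second_difference_mvt[of S g g' v B h p u])
    show "p + s *\<^sub>R v + t *\<^sub>R u \<in> S" if "0 \<le> s" "s \<le> h" "0 \<le> t" "t \<le> h" for s t
      using ball[OF near'[OF that(3,4,1,2)]] by (simp add: add_ac)
  qed (use g B h in auto)
  have "A (p + s *\<^sub>R u + t *\<^sub>R v) v = B (p + t' *\<^sub>R u + s' *\<^sub>R v) u"
  proof -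
    have "h * h * A (p + s *\<^sub>R u + t *\<^sub>R v) v = h * h * B (p + t' *\<^sub>R u + s' *\<^sub>R v) u"
      unfolding eq1[symmetric] using eq2 by (simp add: algebra_simps)
    then show ?thesis using h by simp
  qed
  moreover have "dist (A (p + s *\<^sub>R u + t *\<^sub>R v) v) (A p v) < e"
    using ball[OF near'[OF st]] by simp
  moreover have "dist (B (p + t' *\<^sub>R u + s' *\<^sub>R v) u) (B p u) < e"
    using ball[OF near'[OF st'(3,4,1,2)]] by simp
  ultimately have "\<bar>A p v - B p u\<bar> < 2 * e"
    by (simp add: dist_real_def)
  then show False by (simp add: e_def)
qed

text \<open>The mean value theorem is real, so real and imaginary parts are treated
  separately.\<close>

lemma second_derivative_symmetric_complex:
  fixes g :: "'a::real_normed_vector \<Rightarrow> complex"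
  assumes "open S" "p \<in> S"
    and g: "\<And>x. x \<in> S \<Longrightarrow> (g has_derivative g' x) (at x)"
    and A: "\<And>x. x \<in> S \<Longrightarrow> ((\<lambda>x. g' x u) has_derivative A x) (at x)"
    and B: "\<And>x. x \<in> S \<Longrightarrow> ((\<lambda>x. g' x v) has_derivative B x) (at x)"
    and contA: "continuous_on S (\<lambda>x. A x v)" and contB: "continuous_on S (\<lambda>x. B x u)"
  shows "A p v = B p u"
proof (rule complex_eqI)
  show "Re (A p v) = Re (B p u)"
    by (rule second_derivative_symmetric_real[OF assms(1,2), of "\<lambda>x. Re (g x)" "\<lambda>x v. Re (g' x v)"
          u "\<lambda>x v. Re (A x v)" v "\<lambda>x v. Re (B x v)"])
       (auto intro!: bounded_linear.has_derivative[OF bounded_linear_Re] g A B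
          continuous_intros contA contB)
  show "Im (A p v) = Im (B p u)"
    by (rule second_derivative_symmetric_real[OF assms(1,2), of "\<lambda>x. Im (g x)" "\<lambda>x v. Im (g' x v)"
          u "\<lambda>x v. Im (A x v)" v "\<lambda>x v. Im (B x v)"])
       (auto intro!: bounded_linear.has_derivative[OF bounded_linear_Im] g A B
          continuous_intros contA contB)
qed

text \<open>Elements of \<open>cinf\<close> are extended by zero outside an open set, so derivatives
  of functions that agree only on that set have to be compared.\<close>

lemma frechet_derivative_cong_open:
  assumes "open S" "x \<in> S" "\<And>y. y \<in> S \<Longrightarrow> g y = h y" "g differentiable (at x)"
  shows "(h has_derivative frechet_derivative g (at x)) (at x)"
    and "frechet_derivative h (at x) = frechet_derivative g (at x)"
proof -
  show der: "(h has_derivative frechet_derivative g (at x)) (at x)"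
    using assms by (intro has_derivative_transform_within_open[of g _ x _ S h])
      (auto simp: frechet_derivative_works)
  show "frechet_derivative h (at x) = frechet_derivative g (at x)"
    using frechet_derivative_at[OF der] by simp
qed

lemma Cinf_on_differentiable: "Cinf_on S g \<Longrightarrow> x \<in> S \<Longrightarrow> g differentiable (at x)"
  unfolding Cinf_on_def by (metis Ck_on.simps(2))

section \<open>Partial derivatives on the configurations\<close>

interpretation partial: derivation "partial i"
proof
  show "partial i (g + h) = partial i g + partial i h" for g h
  proof (transfer, rule ext)
    fix i :: 'a and g h :: "(real, 'a) vec \<Rightarrow> complex" and p
    assume "Cinf_on configs g \<and> (\<forall>p. p \<notin> configs \<longrightarrow> g p = 0)"
      "Cinf_on configs h \<and> (\<forall>p. p \<notin> configs \<longrightarrow> h p = 0)"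
    then have "frechet_derivative (\<lambda>p. g p + h p) (at p) =
        (\<lambda>v. frechet_derivative g (at p) v + frechet_derivative h (at p) v)" if "p \<in> configs"
      using that by (intro frechet_derivative_at[symmetric] has_derivative_add)
        (auto simp: frechet_derivative_works[symmetric] Cinf_on_differentiable)
    then show "(if p \<in> configs then frechet_derivative (\<lambda>p. g p + h p) (at p) (axis i 1) else 0) =
        (if p \<in> configs then frechet_derivative g (at p) (axis i 1) else 0) +
        (if p \<in> configs then frechet_derivative h (at p) (axis i 1) else 0)"
      by simp
  qed
  show "partial i (g * h) = partial i g * h + g * partial i h" for g h
  proof (transfer, rule ext)
    fix i :: 'a and g h :: "(real, 'a) vec \<Rightarrow> complex" and p
    assume "Cinf_on configs g \<and> (\<forall>p. p \<notin> configs \<longrightarrow> g p = 0)"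
      "Cinf_on configs h \<and> (\<forall>p. p \<notin> configs \<longrightarrow> h p = 0)"
    then have "frechet_derivative (\<lambda>p. g p * h p) (at p) =
        (\<lambda>v. g p * frechet_derivative h (at p) v + frechet_derivative g (at p) v * h p)"
      if "p \<in> configs"
      using that by (intro frechet_derivative_at[symmetric] has_derivative_mult)
        (auto simp: frechet_derivative_works[symmetric] Cinf_on_differentiable)
    then show "(if p \<in> configs then frechet_derivative (\<lambda>p. g p * h p) (at p) (axis i 1) else 0) =
        (if p \<in> configs then frechet_derivative g (at p) (axis i 1) else 0) * h p +
        g p * (if p \<in> configs then frechet_derivative h (at p) (axis i 1) else 0)"
      by simp
  qed
qed

lemma partial_commute: "partial i (partial j g) = partial j (partial i g)"
proof (transfer, rule ext)
  fix i j :: 'a and g :: "(real, 'a) vec \<Rightarrow> complex" and p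
  assume "Cinf_on configs g \<and> (\<forall>p. p \<notin> configs \<longrightarrow> g p = 0)"
  then have g: "Ck_on k configs g" for k by (auto simp: Cinf_on_def)
  define A where "A u = (\<lambda>x. frechet_derivative (\<lambda>x. frechet_derivative g (at x) u) (at x))" for u
  have C2: "Ck_on (Suc (Suc 0)) configs g" by (rule g)
  have dg: "(g has_derivative frechet_derivative g (at x)) (at x)" if "x \<in> configs" for x
    using C2 that by (auto simp: frechet_derivative_works[symmetric])
  have diff: "(\<lambda>x. frechet_derivative g (at x) u) differentiable (at x)" if "x \<in> configs" for x u
    using C2 that by simp
  have dA: "((\<lambda>x. frechet_derivative g (at x) u) has_derivative A u x) (at x)"
    if "x \<in> configs" for x u
    unfolding A_def using diff[OF that] by (simp add: frechet_derivative_works)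
  have contA: "continuous_on configs (\<lambda>x. A u x v)" for u v
    using C2 by (simp add: A_def)
  \<comment> \<open>The extension by zero of the inner derivative does not affect the outer one on
    the open set of configurations.\<close>
  have eq: "frechet_derivative
      (\<lambda>p. if p \<in> configs then frechet_derivative g (at p) u else 0) (at p) = A u p"
    if "p \<in> configs" for u
    unfolding A_def using that diff by (intro frechet_derivative_cong_open(2)[OF open_configs]) auto
  have "A (axis j 1) p (axis i 1) = A (axis i 1) p (axis j 1)" if "p \<in> configs"
    by (rule second_derivative_symmetric_complex[OF open_configs that dg dA dA contA contA])
  then show "(if p \<in> configs then frechet_derivative
        (\<lambda>p. if p \<in> configs then frechet_derivative g (at p) (axis j 1) else 0) (at p) (axis i 1) else 0) =
      (if p \<in> configs then frechet_derivative
        (\<lambda>p. if p \<in> configs then frechet_derivative g (at p) (axis i 1) else 0) (at p) (axis j 1) else 0)"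
    by (simp add: eq)
qed

lemma partial_coord: "partial i (coord j) = (if i = j then 1 else 0)"
proof -
  have lin: "bounded_linear (\<lambda>p. complex_of_real (p $ j))" for j :: 'a
    by (rule bounded_linear_compose[OF bounded_linear_of_real bounded_linear_vec_nth])
  have fd: "frechet_derivative (\<lambda>p. if p \<in> configs then complex_of_real (p $ j) else 0) (at p) =
      (\<lambda>p. complex_of_real (p $ j))" if "p \<in> configs" for p and j :: 'a
  proof -
    have "((\<lambda>p. if p \<in> configs then complex_of_real (p $ j) else 0) has_derivative
        (\<lambda>p. complex_of_real (p $ j))) (at p)"
      by (rule has_derivative_transform_within_open[OF
            bounded_linear_imp_has_derivative[OF lin] open_configs that]) (simp add: that)
    from frechet_derivative_at[OF this] show ?thesis by simp
  qed
  have "Rep_cinf (partial i (coord j)) = Rep_cinf (if i = j then 1 else 0)"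
    by (rule ext) (simp add: partial.rep_eq coord.rep_eq one_cinf.rep_eq zero_cinf.rep_eq fd axis_def)
  then show ?thesis by (simp add: Rep_cinf_inject)
qed

lemma partial_cconst: "partial i (cconst z) = 0"
proof (transfer, rule ext)
  fix i :: 'a and z :: complex and p :: "(real, 'a) vec"
  have "frechet_derivative (\<lambda>p. if p \<in> configs then z else 0) (at p) =
      frechet_derivative (\<lambda>p. z) (at p)" if "p \<in> configs"
    using that by (intro frechet_derivative_cong_open(2)[OF open_configs]) auto
  then show "(if p \<in> configs then
      frechet_derivative (\<lambda>p. if p \<in> configs then z else 0) (at p) (axis i 1) else 0) = 0"
    by simp
qed

lemma cconst_1: "cconst 1 = 1"
  and cconst_add: "cconst (a + b) = cconst a + cconst b"
  and cconst_mult: "cconst (a * b) = cconst a * cconst b"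
  by (transfer; auto)+

section \<open>The derivations of the polynomial algebra\<close>

lemma poly_mapping_sum_single: "P = (\<Sum>\<alpha>\<in>Poly_Mapping.keys P. Poly_Mapping.single \<alpha> (Poly_Mapping.lookup P \<alpha>))"
  by (rule poly_mapping_eqI)
     (auto simp: lookup_sum lookup_single when_def in_keys_iff sum.delta)

text \<open>Polynomials are finite sums of monomials and both sides of the Leibniz rule are
  biadditive.\<close>

lemma derivation_poly_mappingI:
  fixes d :: "('m::comm_monoid_add \<Rightarrow>\<^sub>0 'a::comm_ring_1) \<Rightarrow> 'm \<Rightarrow>\<^sub>0 'a"
  assumes add: "\<And>P Q. d (P + Q) = d P + d Q"
    and mult: "\<And>\<alpha> \<beta> a b. d (Poly_Mapping.single (\<alpha> + \<beta>) (a * b)) =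
      d (Poly_Mapping.single \<alpha> a) * Poly_Mapping.single \<beta> b
      + Poly_Mapping.single \<alpha> a * d (Poly_Mapping.single \<beta> b)"
  shows "derivation d"
proof
  have d0: "d 0 = 0" using add[of 0 0] by simp
  have sum: "d (sum g A) = (\<Sum>i\<in>A. d (g i))" for g :: "'m \<Rightarrow> _" and A
    by (induction A rule: infinite_finite_induct) (simp_all add: add d0)
  show "d (P * Q) = d P * Q + P * d Q" for P Q
  proof -
    define p where "p \<alpha> = Poly_Mapping.single \<alpha> (Poly_Mapping.lookup P \<alpha>)" for \<alpha>
    define q where "q \<alpha> = Poly_Mapping.single \<alpha> (Poly_Mapping.lookup Q \<alpha>)" for \<alpha>
    have P: "P = sum p (Poly_Mapping.keys P)" and Q: "Q = sum q (Poly_Mapping.keys Q)"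
      unfolding p_def q_def by (rule poly_mapping_sum_single)+
    have pq: "d (p \<alpha> * q \<beta>) = d (p \<alpha>) * q \<beta> + p \<alpha> * d (q \<beta>)" for \<alpha> \<beta>
      unfolding p_def q_def by (simp only: mult_single mult)
    have "d (sum p A * sum q B) = d (sum p A) * sum q B + sum p A * d (sum q B)" for A B
      by (simp add: sum_product sum pq sum.distrib)
    then show ?thesis
      by (metis P Q)
  qed
qed (rule add)

lemma lookup_d_fvar:
  "Poly_Mapping.lookup (d_fvar l P) \<beta> = of_nat (Suc (Poly_Mapping.lookup \<beta> (findex l))) *
    Poly_Mapping.lookup P (\<beta> + Poly_Mapping.single (findex l) 1)"
proof -
  define e :: "nat \<Rightarrow>\<^sub>0 nat" where "e = Poly_Mapping.single (findex l) 1"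
  define t where "t \<alpha> = of_nat (Poly_Mapping.lookup \<alpha> (findex l)) * Poly_Mapping.lookup P \<alpha>" for \<alpha>
  \<comment> \<open>Subtraction of exponents is truncated: \<open>\<alpha> - e = \<beta>\<close>
    holds without \<open>\<alpha> = \<beta> + e\<close> only if \<open>f_l\<close> does not occur in
    \<alpha>, and then \<open>t \<alpha>\<close> is 0.\<close>
  have "(t \<alpha> when \<alpha> - e = \<beta>) = (if \<alpha> = \<beta> + e then t \<alpha> else 0)" for \<alpha>
  proof (cases "Poly_Mapping.lookup \<alpha> (findex l) = 0")
    case True
    then have "t \<alpha> = 0" by (simp add: t_def)
    then show ?thesis by (cases "\<alpha> = \<beta> + e") auto
  next
    case False
    then have "\<alpha> - e + e = \<alpha>"
      by (intro poly_mapping_eqI) (auto simp: e_def lookup_add lookup_minus lookup_single when_def)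
    then have "\<alpha> - e = \<beta> \<longleftrightarrow> \<alpha> = \<beta> + e" by auto
    then show ?thesis by (simp add: when_def)
  qed
  then have "Poly_Mapping.lookup (d_fvar l P) \<beta> =
      (\<Sum>\<alpha>\<in>Poly_Mapping.keys P. if \<alpha> = \<beta> + e then t \<alpha> else 0)"
    by (simp add: d_fvar_def lookup_sum lookup_single e_def t_def)
  also have "\<dots> = t (\<beta> + e)"
    by (auto simp: sum.delta' t_def in_keys_iff)
  finally show ?thesis by (simp add: t_def e_def lookup_add)
qed

lemma d_fvar_single: "d_fvar l (Poly_Mapping.single \<alpha> a) =
  Poly_Mapping.single (\<alpha> - Poly_Mapping.single (findex l) 1)
    (of_nat (Poly_Mapping.lookup \<alpha> (findex l)) * a)"
  by (simp add: d_fvar_def)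

interpretation d_fvar: derivation "d_fvar l"
proof (rule derivation_poly_mappingI)
  show "d_fvar l (P + Q) = d_fvar l P + d_fvar l Q" for P Q :: "'a fspace"
    by (rule poly_mapping_eqI) (simp add: lookup_d_fvar lookup_add algebra_simps)
next
  fix \<alpha> \<beta> and a b :: "'a cinf"
  define e :: "nat \<Rightarrow>\<^sub>0 nat" where "e = Poly_Mapping.single (findex l) 1"
  \<comment> \<open>Truncated subtraction can fail to commute with addition only where the exponent,
    and with it the coefficient, is 0.\<close>
  have *: "Poly_Mapping.single (\<alpha> - e + \<beta>) (of_nat (Poly_Mapping.lookup \<alpha> (findex l)) * c) =
      Poly_Mapping.single (\<alpha> + \<beta> - e) (of_nat (Poly_Mapping.lookup \<alpha> (findex l)) * c)"
    for \<alpha> \<beta> and c :: "'a cinf"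
  proof (cases "Poly_Mapping.lookup \<alpha> (findex l) = 0")
    case False
    then have "\<alpha> - e + \<beta> = \<alpha> + \<beta> - e"
      by (intro poly_mapping_eqI) (auto simp: e_def lookup_add lookup_minus lookup_single when_def)
    then show ?thesis by simp
  qed simp
  show "d_fvar l (Poly_Mapping.single (\<alpha> + \<beta>) (a * b)) =
      d_fvar l (Poly_Mapping.single \<alpha> a) * Poly_Mapping.single \<beta> b +
      Poly_Mapping.single \<alpha> a * d_fvar l (Poly_Mapping.single \<beta> b)"
    using *[of \<alpha> \<beta> "a * b"] *[of \<beta> \<alpha> "a * b"]
    unfolding d_fvar_single e_def[symmetric]
    by (simp add: mult_single lookup_add algebra_simps single_add)
qed

lemma lookup_d_coord: "Poly_Mapping.lookup (d_coord i P) \<alpha> = partial i (Poly_Mapping.lookup P \<alpha>)"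
  by (simp add: d_coord_def map.rep_eq when_def)

lemma d_coord_single: "d_coord i (Poly_Mapping.single \<alpha> a) = Poly_Mapping.single \<alpha> (partial i a)"
  by (simp add: d_coord_def)

interpretation d_coord: derivation "d_coord i"
proof (rule derivation_poly_mappingI)
  show "d_coord i (P + Q) = d_coord i P + d_coord i Q" for P Q :: "'a fspace"
    by (rule poly_mapping_eqI) (simp add: lookup_d_coord lookup_add partial.add)
  show "d_coord i (Poly_Mapping.single (\<alpha> + \<beta>) (a * b)) =
      d_coord i (Poly_Mapping.single \<alpha> a) * Poly_Mapping.single \<beta> b +
      Poly_Mapping.single \<alpha> a * d_coord i (Poly_Mapping.single \<beta> b)" for \<alpha> \<beta> and a b :: "'a cinf"
    by (simp add: d_coord_single mult_single partial.mult single_add)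
qed

text \<open>A single index type for the indeterminates \<open>f_(-2-k)\<close> and the coordinates
  makes each \<open>V_n\<close> one vector field.\<close>

definition d_gen :: "nat + 'd::{finite,linorder} \<Rightarrow> 'd fspace \<Rightarrow> 'd fspace" where
  "d_gen = case_sum (\<lambda>k. d_fvar (- 2 - int k)) d_coord"

lemma d_gen_simps [simp]: "d_gen (Inl k) = d_fvar (- 2 - int k)" "d_gen (Inr i) = d_coord i"
  by (simp_all add: d_gen_def)

lemma findex_of_nat [simp]: "findex (- 2 - int k) = k"
  by (simp add: findex_def)

interpretation gen: commuting_derivations d_gen
proof
  fix s t :: "nat + 'a" and P :: "'a fspace"
  show "d_gen t (P + Q) = d_gen t P + d_gen t Q" "d_gen t (P * Q) = d_gen t P * Q + P * d_gen t Q"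
    for Q by (cases t; simp add: d_fvar.add d_coord.add d_fvar.mult d_coord.mult)+
  have ff: "d_fvar k (d_fvar l P) = d_fvar l (d_fvar k P)" for k l
    by (cases "findex k = findex l"; rule poly_mapping_eqI)
       (simp_all add: lookup_d_fvar lookup_add lookup_single add_ac mult_ac)
  have fc: "d_fvar k (d_coord i P) = d_coord i (d_fvar k P)" for k i
    by (rule poly_mapping_eqI)
       (simp add: lookup_d_fvar lookup_d_coord partial.mult partial.add)
  have cc: "d_coord i (d_coord j P) = d_coord j (d_coord i P)" for i j
    by (rule poly_mapping_eqI) (simp add: lookup_d_coord partial_commute)
  show "d_gen s (d_gen t P) = d_gen t (d_gen s P)"
    by (cases s; cases t; simp add: ff fc cc)
  have "finite {k. d_fvar (- 2 - int k) P \<noteq> 0}"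
  proof (rule finite_surj[OF finite_d_fvar[of P]])
    show "{k. d_fvar (- 2 - int k) P \<noteq> 0} \<subseteq> findex ` {l. l \<le> - 2 \<and> d_fvar l P \<noteq> 0}"
      by (auto intro!: image_eqI[of _ _ "- 2 - int _"])
  qed
  then have "finite ({k. d_fvar (- 2 - int k) P \<noteq> 0} <+> (UNIV :: 'a set))" by simp
  then show "finite {t. d_gen t P \<noteq> 0}"
  proof (rule finite_subset[rotated], safe)
    fix t assume "d_gen t P \<noteq> 0"
    then show "t \<in> {k. d_fvar (- 2 - int k) P \<noteq> 0} <+> (UNIV :: 'a set)"
      by (cases t) auto
  qed
qed

section \<open>The operators\<close>

lemma scalar_1: "scalar 1 = 1"
  and scalar_add: "scalar (a + b) = scalar a + scalar b"
  and scalar_mult: "scalar (a * b) = scalar a * scalar b"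
  by (simp_all add: scalar_def coeff_def cconst_1 cconst_add cconst_mult single_add mult_single)

lemma scalar_0 [simp]: "scalar 0 = 0"
  using scalar_add[of 0 0] by simp

lemma scalar_uminus: "scalar (- a) = - scalar a"
  using scalar_add[of a "- a"] by (simp add: eq_neg_iff_add_eq_0 add.commute)

lemma scalar_of_nat: "scalar (of_nat n) = of_nat n"
  by (induction n) (simp_all add: scalar_1 scalar_add)

lemma scalar_of_int: "scalar (of_int k) = of_int k"
  by (cases k) (simp_all only: of_int_minus of_int_of_nat_eq scalar_uminus scalar_of_nat)

lemma d_gen_scalar [simp]: "d_gen t (scalar a) = 0"
proof (cases t)
  case (Inl k)
  then show ?thesis by (simp add: scalar_def coeff_def d_fvar_single)
next
  case (Inr i)
  then show ?thesis by (simp add: scalar_def coeff_def d_coord_single partial_cconst)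
qed

lemma d_gen_fvar: "d_gen t (fvar (- 2 - int k)) = (if t = Inl k then 1 else 0)"
proof (cases t)
  case (Inl j)
  have "Poly_Mapping.lookup (Poly_Mapping.single k 1) j = (if k = j then 1 else (0::nat))"
    by (simp add: lookup_single when_def)
  with Inl show ?thesis by (auto simp: fvar_def d_fvar_single)
next
  case (Inr i)
  then show ?thesis by (simp add: fvar_def d_coord_single)
qed

lemma d_gen_coord: "d_gen t (coeff (coord i)) = (if t = Inr i then 1 else 0)"
proof (cases t)
  case (Inl k)
  then show ?thesis by (simp add: coeff_def d_fvar_single)
next
  case (Inr j)
  then show ?thesis by (simp add: coeff_def d_coord_single partial_coord)
qed

lemma field_scalar: "gen.field v (scalar a) = 0"
  by (simp add: gen.field_def)

lemma field_fvar: "gen.field v (fvar (- 2 - int k)) = v (Inl k)"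
  by (simp add: gen.field_def d_gen_fvar)

lemma field_coord: "gen.field v (coeff (coord i)) = v (Inr i)"
  by (simp add: gen.field_def d_gen_coord)

section \<open>The universal series and its vector fields\<close>

lemma f_u_nth: "f_u $$ j = (if j = - 1 then 1 else if j \<ge> 1 then fvar (- j - 1) else 0)"
  using zseries_nth[of fvar "- j"] by (auto simp: f_u_def)

interpretation fser: monic_series "f_u :: 'd::{finite,linorder} fspace fls"
proof
  fix k and x :: "'d fspace"
  assume "of_int k * x = 0"
  \<comment> \<open>Nonzero integers are invertible because the algebra contains the complex
    scalars.\<close>
  then have "scalar (1 / of_int k) * (of_int k * x) = 0" by simp
  then have "scalar (1 / of_int k * of_int k) * x = 0"
    by (simp only: scalar_mult scalar_of_int mult.assoc)
  then show "k = 0 \<or> x = 0" by (cases "k = 0") (simp_all add: scalar_1)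
qed (simp_all add: f_u_nth)

text \<open>The component along \<open>f_(-2-k)\<close>: the coefficient of \<open>z^(-1-k)\<close>
  in \<open>p_n(f) - G n\<close>, in the form of \<open>ev_pp_minus_G\<close> with
  \<open>K = Suc k\<close>.\<close>

definition f_coeff :: "int \<Rightarrow> nat \<Rightarrow> 'd::{finite,linorder} fspace" where
  "f_coeff n k = - (\<Sum>m<Suc k. (fser.g ^ Suc m) $$ int (Suc k) * Res (zpow (1 - n) * (fser.\<phi> ^ 2 * f_u ^ m)))"

definition vfield :: "int \<Rightarrow> 'd::{finite,linorder} fspace \<Rightarrow> 'd fspace" where
  "vfield n = gen.field (case_sum (f_coeff n) (\<lambda>i. poly (fser.pp n) (coeff (coord i))))"

lemma derivation_vfield: "derivation (vfield n)"
  unfolding vfield_def by (rule gen.derivation_field)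

lemma vfield_scalar: "vfield n (scalar a) = 0"
  by (simp add: vfield_def field_scalar)

lemma vfield_fvar: "vfield n (fvar (- 2 - int k)) = f_coeff n k"
  by (simp add: vfield_def field_fvar)

lemma vfield_coord: "vfield n (coeff (coord i)) = poly (fser.pp n) (coeff (coord i))"
  by (simp add: vfield_def field_coord)

interpretation flow: virasoro_flow f_u vfield "scalar (1 / 2) :: 'd::{finite,linorder} fspace"
proof (intro virasoro_flow.intro virasoro_flow_axioms.intro)
  show "monic_series (f_u :: 'd fspace fls)" by (rule fser.monic_series_axioms)
  show "derivation (vfield n :: 'd fspace \<Rightarrow> _)" for n by (rule derivation_vfield)
  show "derivation.lift (vfield n :: 'd fspace \<Rightarrow> _) f_u = ev (fser.pp n) f_u - fser.G n" for n
  proof (rule fls_eqI)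
    interpret derivation "vfield n :: 'd fspace \<Rightarrow> _" by (rule derivation_vfield)
    fix j
    show "lift f_u $$ j = (ev (fser.pp n) f_u - fser.G n) $$ j"
    \<comment> \<open>At indices up to 0 the coefficients of \<open>f_u\<close> are constants and
      the right-hand side vanishes; at positive indices they are indeterminates, on which the field
      takes its components as values.\<close>
    proof (cases "j \<le> 0")
      case True
      then show ?thesis using fser.ev_pp_minus_G_nonpos[of j n]
        by (cases "j = -1") (simp_all add: f_u_nth)
    next
      case False
      define k where "k = nat (j - 1)"
      have j: "j = int (Suc k)" using False by (simp add: k_def)
      have "f_u $$ j = (fvar (- 2 - int k) :: 'd fspace)"
        unfolding j by (simp add: f_u_nth)
      then have "lift f_u $$ j = f_coeff n k" by (simp add: vfield_fvar)
      then show ?thesis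
        unfolding f_coeff_def by (subst fser.ev_pp_minus_G[of j "Suc k"]) (simp_all add: j)
    qed
  qed
  show "2 * scalar (1 / 2) = (1 :: 'd fspace)"
    using scalar_add[of "1/2" "1/2"] by (simp add: scalar_1)
qed

text \<open>By \<open>field_commutator\<close> it suffices to compare components, that is, to
  compute the commutator on the coefficients of \<open>f_u\<close> and on the coordinates.\<close>

lemma vfield_commutator:
  fixes P :: "'d::{finite,linorder} fspace"
  shows "vfield n (vfield m P) - vfield m (vfield n P) = of_int (n - m) * vfield (n + m) P"
proof -
  define v :: "int \<Rightarrow> nat + 'd \<Rightarrow> 'd fspace"
    where "v n = case_sum (f_coeff n) (\<lambda>i. poly (fser.pp n) (coeff (coord i)))" for n
  have vfield: "vfield n = gen.field (v n)" for n by (simp add: vfield_def v_def)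
  have "vfield n (v m t) - vfield m (v n t) = of_int (n - m) * v (n + m) t" for t
  proof (cases t)
    case (Inl k)
    have "f_u $$ int (Suc k) = (fvar (- 2 - int k) :: 'd fspace)" by (simp add: f_u_nth)
    moreover have "vfield n (vfield m (f_u $$ int (Suc k) :: 'd fspace)) - vfield m (vfield n (f_u $$ int (Suc k))) =
        of_int (n - m) * vfield (n + m) (f_u $$ int (Suc k))"
      by (rule flow.V_commutator_nth)
    ultimately show ?thesis by (simp add: Inl v_def vfield_fvar)
  next
    case (Inr i)
    then show ?thesis
      using flow.point_commutator[of "coeff (coord i)" n m, OF vfield_coord] by (simp add: v_def vfield_coord)
  qed
  then have "vfield n (vfield m P) - vfield m (vfield n P) = gen.field (\<lambda>t. of_int (n - m) * v (n + m) t) P"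
    unfolding vfield by (simp add: gen.field_commutator)
  then show ?thesis
    by (simp add: vfield gen.field_def sum_distrib_left mult_ac)
qed

section \<open>Evaluation of the residues in the operators\<close>

lemma schwarzian_f_u:
  "schwarzian f_u = fser.sch (scalar (1 / 2) :: 'd::{finite,linorder} fspace)"
proof -
  have "scalar (3 / 2) = (1 :: 'd fspace) + scalar (1 / 2)"
    using scalar_add[of 1 "1/2"] by (simp add: scalar_1)
  then show ?thesis
    unfolding schwarzian_def fser.sch_def[OF flow.h]
    by (simp add: fser.a_def zderiv.mult fser.zderiv_\<psi> fls_const_plus algebra_simps power2_eq_square
        flip: fser.\<phi>_def fser.\<psi>_def)
qed

text \<open>Embedding coefficients as constants is multiplicative, so it carries the inverse of
  \<open>f_u\<close> to an inverse of \<open>f_z\<close>; inverses are unique.\<close>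

lemma zinv_f_z: "zinv f_z = fls_map fls_const (fser.g :: 'd::{finite,linorder} fspace fls)"
proof -
  define F :: "'d fspace fls fls" where "F = f_z"
  define g :: "'d fspace fls" where "g = fser.g"
  have F: "F = fls_map fls_const f_u"
  proof (rule fls_eqI)
    fix j
    show "F $$ j = fls_map fls_const f_u $$ j"
      using zseries_nth[of "\<lambda>m. fls_const (fvar m :: 'd fspace)" "- j"]
      by (simp add: fls_map_nth f_u_nth F_def f_z_def)
  qed
  have 1: "F * zinv F = 1"
    by (rule zinv_nth_le(1)[of _ "-1"]) (simp_all add: F fls_map_nth f_u_nth)
  have "F * fls_map fls_const g = fls_map fls_const (f_u * g)"
    unfolding F by (rule fls_map_mult[symmetric]) (simp_all add: fls_const_plus)
  also have "f_u * g = 1"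
    unfolding g_def by (rule fser.f_g)
  also have "fls_map fls_const 1 = (1 :: 'd fspace fls fls)"
    by (rule fls_eqI) (simp add: fls_map_nth)
  finally have 2: "F * fls_map fls_const g = 1" .
  have "zinv F = zinv F * (F * fls_map fls_const g)"
    by (simp only: 2 mult_1_right)
  also have "\<dots> = (F * zinv F) * fls_map fls_const g"
    by (simp only: mult_ac)
  finally have "zinv F = fls_map fls_const g"
    by (simp only: 1 mult_1_left)
  then show ?thesis by (simp add: F_def g_def)
qed

lemma zinv_f_z_power_nth:
  fixes j :: int
  shows "(zinv f_z ^ n) $$ j = fls_const ((fser.g ^ n) $$ j :: 'd::{finite,linorder} fspace)"
proof -
  have "zinv f_z ^ n = fls_map fls_const (fser.g ^ n :: 'd fspace fls)"
  proof (induction n)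
    case 0
    show ?case by (rule fls_eqI) (simp add: fls_map_nth)
  next
    case (Suc n)
    then show ?case
      by (simp add: zinv_f_z) (rule fls_map_mult[symmetric], simp_all add: fls_const_plus)
  qed
  then show ?thesis by (simp add: fls_map_nth)
qed

text \<open>The residue in \<open>z\<close> against \<open>z^k\<close> selects the coefficient of
  \<open>z^(-1-k)\<close>, to which only the terms \<open>m < Suc k\<close> of the expansion
  contribute.\<close>

lemma Res_f_coeff:
  "Res (zpow (1 - n) * Res (fls_const (zderiv f_u ^ 2) * zpow (- 2 - (- 2 - int k)) * expand 0 f_z f_u)) =
    - (f_coeff n k :: 'd::{finite,linorder} fspace)"
proof -
  have zinv_below: "zinv f_z $$ i = (0 :: 'd fspace fls)" if "i \<le> 0" for i
    using that unfolding f_z_def by (rule zinv_zseries_nth)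
  have exp: "expand 0 f_z f_u $$ int (Suc k) = (\<Sum>m<Suc k. fls_const ((fser.g ^ Suc m) $$ int (Suc k) :: 'd fspace) * f_u ^ m)"
    by (subst expand_sums(2)[OF zinv_below])
       (simp_all add: zinv_f_z_power_nth nat_add_distrib del: power_Suc sum.lessThan_Suc)
  have "Res (fls_const (zderiv f_u ^ 2) * zpow (- 2 - (- 2 - int k)) * expand 0 f_z f_u) =
      (zderiv f_u ^ 2 :: 'd fspace fls) * expand 0 f_z f_u $$ int (Suc k)"
    by (simp add: Res_def mult.assoc zpow_mult_nth)
  also have "\<dots> = (\<Sum>m<Suc k. fls_const ((fser.g ^ Suc m) $$ int (Suc k)) * (fser.\<phi> ^ 2 * f_u ^ m))"
    unfolding exp fser.\<phi>_def by (simp only: sum_distrib_left mult_ac)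
  also have "zpow (1 - n) * \<dots> = (\<Sum>m<Suc k. fls_const ((fser.g ^ Suc m) $$ int (Suc k)) *
      (zpow (1 - n) * (fser.\<phi> ^ 2 * f_u ^ m)))"
    by (simp only: sum_distrib_left mult_ac)
  also have "Res \<dots> = - f_coeff n k"
    by (simp only: Res_sum Res_const_mult f_coeff_def minus_minus)
  finally show ?thesis .
qed

text \<open>The residues against \<open>f^(-1-m)\<close> are the coefficients of
  \<open>pp n\<close>, so \<open>j = 0\<close> yields \<open>p_n(r)\<close> and
  \<open>j = 1\<close>, with binomial \<open>m\<close>, yields \<open>p_n'(r)\<close>.\<close>

lemma Res_expand:
  "Res (zpow (1 - n) * (zderiv f_u ^ 2 * expand j f_u (r :: 'd::{finite,linorder} fspace))) =
    (\<Sum>m<nat (2 - n). of_nat (m choose j) * poly.coeff (fser.pp n) m * r ^ (m - j))"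
proof -
  define K where "K = nat (2 - n)"
  define H :: "'d fspace fls" where "H = fser.\<phi> * fser.G n"
  define E :: "'d fspace fls" where "E = (\<Sum>m<K. fls_const (of_nat (m choose j) * r ^ (m - j)) * fser.g ^ Suc m)"
  have g_below: "(fser.g ^ Suc m) $$ i = (0 :: 'd fspace)" if "i < int (Suc m)" for m i
    using fser.fpow_below[of i "- int (Suc m)"] that unfolding fser.fpow_neg by simp
  have zinv_below: "zinv f_u $$ i = (0 :: 'd fspace)" if "i \<le> 0" for i
    using that unfolding f_u_def by (rule zinv_zseries_nth)
  have "expand j f_u r $$ i = E $$ i" if "i < int K + 1" for i
  proof -
    have "expand j f_u r $$ i = (\<Sum>m<nat i. of_nat (m choose j) * (fser.g ^ Suc m) $$ i * r ^ (m - j))"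
      by (subst expand_sums(2)[OF zinv_below]) (simp_all add: fser.g_def)
    also have "\<dots> = (\<Sum>m<K. of_nat (m choose j) * (fser.g ^ Suc m) $$ i * r ^ (m - j))"
      using that by (intro sum.mono_neutral_left) (auto simp: g_below simp del: power_Suc)
    finally show ?thesis
      by (simp add: E_def fls_nth_sum del: power_Suc) (simp only: mult_ac)
  qed
  moreover have "H $$ i = 0" if "i < n - 1" for i
    unfolding H_def using that
    by (intro fls_mult_nth_below[where a = 0 and b = "n - 1"] fser.\<phi>_below fser.G_below) auto
  \<comment> \<open>\<open>H\<close> starts at index \<open>n - 1\<close> and the truncation error
    at \<open>K + 1\<close>, so their product starts at \<open>n + K\<close>, at least 2, beyond the
    residue.\<close>
  ultimately have "(H * (expand j f_u r - E)) $$ 1 = 0"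
    by (intro fls_mult_nth_below[where a = "n - 1" and b = "int K + 1"]) (auto simp: K_def)
  then have "Res (H * expand j f_u r) = Res (H * E)"
    by (simp add: Res_def right_diff_distrib)
  also have "H * E = (\<Sum>m<K. fls_const (of_nat (m choose j) * r ^ (m - j)) *
      (fser.\<phi> * fser.g ^ Suc m * fser.G n))"
    unfolding E_def H_def by (simp only: sum_distrib_left mult_ac)
  also have "Res \<dots> = (\<Sum>m<K. of_nat (m choose j) * poly.coeff (fser.pp n) m * r ^ (m - j))"
    by (simp only: Res_sum Res_const_mult fser.coeff_pp) (simp only: mult_ac)
  also have "H * expand j f_u r = zpow (1 - n) * (zderiv f_u ^ 2 * expand j f_u r)"
    by (simp add: H_def fser.G_def power2_eq_square mult_ac flip: fser.\<phi>_def)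
  finally show ?thesis by (simp add: K_def)
qed

lemma pp_sum_monom: "fser.pp n = (\<Sum>m<nat (2 - n). monom (poly.coeff (fser.pp n) m) m)"
  by (subst fser.pp_def) (simp add: fser.coeff_pp)

lemma Res_expand_0:
  "Res (zpow (1 - n) * (zderiv f_u ^ 2 * expand 0 f_u r)) = poly (fser.pp n) r"
  unfolding Res_expand by (subst (2) pp_sum_monom) (simp add: poly_sum poly_monom)

lemma Res_expand_1:
  "Res (zpow (1 - n) * (zderiv f_u ^ 2 * expand 1 f_u r)) =
    poly (pdiff (fser.pp n)) (r :: 'd::{finite,linorder} fspace)"
proof -
  have pdiff_sum: "pdiff (sum p A) = (\<Sum>i\<in>A. pdiff (p i))" for p :: "nat \<Rightarrow> 'd fspace poly" and A
    by (induction A rule: infinite_finite_induct) (simp_all add: pdiff_add)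
  have "poly (pdiff (monom a m)) r = of_nat m * a * r ^ (m - 1)" for a m
    by (cases m) (simp_all add: pdiff_monom_Suc poly_monom monom_0 pdiff_pCons)
  then show ?thesis
    unfolding Res_expand by (subst (2) pp_sum_monom) (simp add: poly_sum pdiff_sum)
qed

section \<open>Splitting the operators into multiplications and derivations\<close>

definition mult_part ::
    "complex \<Rightarrow> nat \<Rightarrow> nat \<Rightarrow> (nat \<Rightarrow> 'd) \<Rightarrow> (nat \<Rightarrow> 'd) \<Rightarrow> (nat \<Rightarrow> complex) \<Rightarrow> (nat \<Rightarrow> complex)
     \<Rightarrow> int \<Rightarrow> 'd::{finite,linorder} fspace" where
  "mult_part c N M ix iy dx dy n = scalar (c / 12) * fser.S (scalar (1 / 2)) n
     + (\<Sum>I=1..N. scalar (dx I) * poly (pdiff (fser.pp n)) (coeff (coord (ix I))))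
     + (\<Sum>K=1..M. scalar (dy K) * poly (pdiff (fser.pp n)) (coeff (coord (iy K))))"

lemma Lop_eq:
  fixes P :: "'d::{finite,linorder} fspace"
  assumes "bij_betw (case_sum ix iy) ({1..N} <+> {1..M}) (UNIV :: 'd set)"
  shows "Lop c N M ix iy dx dy n P = mult_part c N M ix iy dx dy n * P + vfield n P"
proof -
  define p :: "'d fspace poly" where "p = fser.pp n"
  define A where "A = {k. d_fvar (- 2 - int k) P \<noteq> 0}"
  define cf where "cf i = poly p (coeff (coord i)) * d_coord i P" for i
  have point: "Res (zpow (1 - n) * (zderiv f_u ^ 2 *
        (fls_const (scalar z) * expand 1 f_u (coeff (coord i)) * fls_const P
         + expand 0 f_u (coeff (coord i)) * fls_const (d_coord i P)))) =
      scalar z * poly (pdiff p) (coeff (coord i)) * P + cf i" for z i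
  proof -
    have "zpow (1 - n) * (zderiv f_u ^ 2 *
        (fls_const (scalar z) * expand 1 f_u (coeff (coord i)) * fls_const P
         + expand 0 f_u (coeff (coord i)) * fls_const (d_coord i P))) =
      fls_const (scalar z) * ((zpow (1 - n) * (zderiv f_u ^ 2 * expand 1 f_u (coeff (coord i)))) * fls_const P)
      + (zpow (1 - n) * (zderiv f_u ^ 2 * expand 0 f_u (coeff (coord i)))) * fls_const (d_coord i P)"
      by (simp add: algebra_simps)
    then show ?thesis
      by (simp only: Res_add Res_const_mult Res_mult_const Res_expand_0 Res_expand_1)
         (simp add: p_def cf_def mult_ac)
  qed
  have schw: "Res (zpow (1 - n) * (fls_const (scalar (c / 12)) * schwarzian f_u * fls_const P)) =
      scalar (c / 12) * fser.S (scalar (1 / 2)) n * P"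
  proof -
    have "zpow (1 - n) * (fls_const (scalar (c / 12)) * schwarzian f_u * fls_const P) =
        fls_const (scalar (c / 12)) * ((zpow (1 - n) * schwarzian f_u) * fls_const P)"
      by (simp only: mult_ac)
    then show ?thesis
      unfolding schwarzian_f_u fser.S_def[OF flow.h]
      by (simp only: Res_const_mult Res_mult_const) (simp only: mult.assoc)
  qed
  \<comment> \<open>This minus sign cancels the one in front of the sum in
    \<open>Lop\<close>.\<close>
  have fpart: "Res (zpow (1 - n) * (\<Sum>l | l \<le> - 2 \<and> d_fvar l P \<noteq> 0.
        Res (fls_const (zderiv f_u ^ 2) * zpow (- 2 - l) * expand 0 f_z f_u)
        * fls_const (d_fvar l P))) = - (\<Sum>k\<in>A. f_coeff n k * d_fvar (- 2 - int k) P)"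
  proof -
    have "Res (zpow (1 - n) * (\<Sum>l | l \<le> - 2 \<and> d_fvar l P \<noteq> 0.
        Res (fls_const (zderiv f_u ^ 2) * zpow (- 2 - l) * expand 0 f_z f_u)
        * fls_const (d_fvar l P))) =
      (\<Sum>l | l \<le> - 2 \<and> d_fvar l P \<noteq> 0.
        Res (zpow (1 - n) * Res (fls_const (zderiv f_u ^ 2) * zpow (- 2 - l) * expand 0 f_z f_u))
        * d_fvar l P)"
      unfolding sum_distrib_left mult.assoc[symmetric] Res_sum Res_mult_const ..
    also have "\<dots> = (\<Sum>k\<in>A.
        Res (zpow (1 - n) * Res (fls_const (zderiv f_u ^ 2) * zpow (- 2 - (- 2 - int k)) * expand 0 f_z f_u))
        * d_fvar (- 2 - int k) P)"
      by (rule sum.reindex_bij_witness[of _ "\<lambda>k. - 2 - int k" "\<lambda>l. nat (- 2 - l)"])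
         (auto simp: A_def)
    also have "\<dots> = - (\<Sum>k\<in>A. f_coeff n k * d_fvar (- 2 - int k) P)"
      unfolding Res_f_coeff by (simp add: sum_negf)
    finally show ?thesis .
  qed
  have "finite A"
  proof -
    have "A = Inl -` {t. d_gen t P \<noteq> 0}" by (auto simp: A_def)
    then show ?thesis
      using finite_vimageI[OF gen.finite_support[of P], of Inl] by simp
  qed
  \<comment> \<open>\<open>ix\<close> and \<open>iy\<close> together list every coordinate exactly
    once, so both families of points combine into the sum over all coordinates in
    \<open>vfield\<close>.\<close>
  have "(\<Sum>I=1..N. cf (ix I)) + (\<Sum>K=1..M. cf (iy K)) = (\<Sum>t\<in>{1..N} <+> {1..M}. cf (case_sum ix iy t))"
    by (simp add: sum.Plus)
  also have "\<dots> = (\<Sum>i\<in>UNIV. cf i)"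
    using assms by (rule sum.reindex_bij_betw)
  finally have cf: "(\<Sum>I=1..N. cf (ix I)) + (\<Sum>K=1..M. cf (iy K)) = (\<Sum>i\<in>UNIV. cf i)" .
  have "vfield n P = (\<Sum>t\<in>A <+> UNIV. case_sum (f_coeff n) (\<lambda>i. poly (fser.pp n) (coeff (coord i))) t * d_gen t P)"
    unfolding vfield_def
  proof (rule gen.field_eq)
    show "finite (A <+> (UNIV :: 'd set))" using \<open>finite A\<close> by simp
    show "{t. d_gen t P \<noteq> 0} \<subseteq> A <+> UNIV"
    proof safe
      fix t assume "d_gen t P \<noteq> 0"
      then show "t \<in> A <+> UNIV" by (cases t) (auto simp: A_def)
    qed
  qed
  also have "\<dots> = (\<Sum>k\<in>A. f_coeff n k * d_fvar (- 2 - int k) P) + (\<Sum>i\<in>UNIV. cf i)"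
    using \<open>finite A\<close> by (simp add: sum.Plus cf_def p_def)
  finally have vfield: "vfield n P = (\<Sum>k\<in>A. f_coeff n k * d_fvar (- 2 - int k) P)
      + ((\<Sum>I=1..N. cf (ix I)) + (\<Sum>K=1..M. cf (iy K)))"
    unfolding cf .
  show ?thesis
    unfolding Lop_def distrib_left[of "zpow (1 - n)"] right_diff_distrib[of "zpow (1 - n)"]
      Res_add Res_diff schw fpart
    unfolding sum_distrib_left[of "zpow (1 - n)"] Res_sum point vfield mult_part_def
    by (simp add: sum.distrib distrib_right sum_distrib_right p_def)
qed

text \<open>The weights and \<open>c\<close> are constants, so the identity holds summand by
  summand; the central term comes from the Schwarzian.\<close>

lemma mult_part_commutator:
  "vfield n (mult_part c N M ix iy dx dy m) - vfield m (mult_part c N M ix iy dx dy n) =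
    of_int (n - m) * mult_part c N M ix iy dx dy (n + m)
    + (if n + m = 0 then scalar (c / 12 * of_int (n ^ 3 - n)) else (0 :: 'd::{finite,linorder} fspace))"
proof -
  define Sc :: "int \<Rightarrow> 'd fspace" where "Sc = fser.S (scalar (1 / 2))"
  define q :: "int \<Rightarrow> 'd \<Rightarrow> 'd fspace" where "q n i = poly (pdiff (fser.pp n)) (coeff (coord i))" for n i
  have Sc: "vfield n (Sc m) - vfield m (Sc n) =
      of_int (n - m) * Sc (n + m) + (if n + m = 0 then of_int (n ^ 3 - n) else 0)" for n m
    unfolding Sc_def by (rule flow.S_commutator)
  have q: "vfield n (q m i) - vfield m (q n i) = of_int (n - m) * q (n + m) i" for n m i
    unfolding q_def by (rule flow.point_pdiff_commutator) (rule vfield_coord)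
  have vfield: "vfield n (mult_part c N M ix iy dx dy m) = scalar (c / 12) * vfield n (Sc m)
      + (\<Sum>I=1..N. scalar (dx I) * vfield n (q m (ix I))) + (\<Sum>K=1..M. scalar (dy K) * vfield n (q m (iy K)))" for n m
  proof -
    interpret derivation "vfield n :: 'd fspace \<Rightarrow> _" by (rule derivation_vfield)
    show ?thesis
      unfolding mult_part_def Sc_def[symmetric] q_def[symmetric]
      by (simp add: add mult sum vfield_scalar)
  qed
  have "vfield n (mult_part c N M ix iy dx dy m) - vfield m (mult_part c N M ix iy dx dy n) =
      scalar (c / 12) * (vfield n (Sc m) - vfield m (Sc n))
      + (\<Sum>I=1..N. scalar (dx I) * (vfield n (q m (ix I)) - vfield m (q n (ix I))))
      + (\<Sum>K=1..M. scalar (dy K) * (vfield n (q m (iy K)) - vfield m (q n (iy K))))"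
    unfolding vfield right_diff_distrib sum_subtractf by simp
  also have "\<dots> = of_int (n - m) * mult_part c N M ix iy dx dy (n + m)
      + scalar (c / 12) * (if n + m = 0 then of_int (n ^ 3 - n) else 0)"
    unfolding Sc q mult_part_def Sc_def[symmetric] q_def[symmetric] distrib_left sum_distrib_left
    by (simp only: mult_ac add_ac)
  also have "scalar (c / 12) * (if n + m = 0 then of_int (n ^ 3 - n) else 0) =
      (if n + m = 0 then scalar (c / 12 * of_int (n ^ 3 - n)) else (0 :: 'd fspace))"
    by (simp only: scalar_mult scalar_of_int) simp
  finally show ?thesis .
qed

text \<open>Multiplication operators commute, so the commutator is multiplication by
  \<open>V_n A_m - V_m A_n\<close> plus \<open>[V_n, V_m]\<close>.\<close>

lemma Lop_commutator:
  fixes P :: "'d::{finite,linorder} fspace" and c :: complex and dx dy :: "nat \<Rightarrow> complex"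
  assumes "bij_betw (case_sum ix iy) ({1..N} <+> {1..M}) (UNIV :: 'd set)"
  defines "L \<equiv> Lop c N M ix iy dx dy"
  shows "L n (L m P) - L m (L n P) = scaleF (of_int (n - m)) (L (n + m) P)
    + (if n + m = 0 then scaleF (c / 12 * of_int (n ^ 3 - n)) P else 0)"
proof -
  define A :: "int \<Rightarrow> 'd fspace" where "A = mult_part c N M ix iy dx dy"
  have L: "L n P = A n * P + vfield n P" for n P
    unfolding L_def A_def by (rule Lop_eq[OF assms(1)])
  have A: "vfield n (A m) - vfield m (A n) = of_int (n - m) * A (n + m)
      + (if n + m = 0 then scalar (c / 12 * of_int (n ^ 3 - n)) else 0)"
    unfolding A_def by (rule mult_part_commutator)
  have LL: "L n (L m P) = A n * A m * P + A n * vfield m P + A m * vfield n P + vfield n (A m) * P + vfield n (vfield m P)" for n m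
  proof -
    interpret derivation "vfield n :: 'd fspace \<Rightarrow> _" by (rule derivation_vfield)
    show ?thesis by (simp add: L add mult algebra_simps)
  qed
  have "L n (L m P) - L m (L n P) = (vfield n (A m) - vfield m (A n)) * P + (vfield n (vfield m P) - vfield m (vfield n P))"
    unfolding LL by (simp add: algebra_simps)
  then show ?thesis
    unfolding A vfield_commutator L scaleF_def
    by (simp add: scalar_of_int distrib_right mult.assoc distrib_left del: of_int_diff)
qed

lemma Lop_linear:
  fixes P Q :: "'d::{finite,linorder} fspace"
  assumes "bij_betw (case_sum ix iy) ({1..N} <+> {1..M}) (UNIV :: 'd set)"
  shows "Lop c N M ix iy dx dy n (P + Q) = Lop c N M ix iy dx dy n P + Lop c N M ix iy dx dy n Q"
    and "Lop c N M ix iy dx dy n (scaleF z P) = scaleF z (Lop c N M ix iy dx dy n P)"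
proof -
  interpret derivation "vfield n :: 'd fspace \<Rightarrow> _" by (rule derivation_vfield)
  show "Lop c N M ix iy dx dy n (P + Q) = Lop c N M ix iy dx dy n P + Lop c N M ix iy dx dy n Q"
    "Lop c N M ix iy dx dy n (scaleF z P) = scaleF z (Lop c N M ix iy dx dy n P)"
    unfolding Lop_eq[OF assms] scaleF_def by (simp_all add: add mult vfield_scalar algebra_simps)
qed

section \<open>Representations of the Virasoro algebra\<close>

lemma vector_space_scaleF: "vector_space scaleF"
  by standard (simp_all add: scaleF_def scalar_add scalar_mult scalar_1 algebra_simps)

lemma lookup_vir_scale: "Poly_Mapping.lookup (vir_scale s a) k = s * Poly_Mapping.lookup a k"
  by (simp add: vir_scale_def map.rep_eq when_def)

lemma vector_space_vir_scale: "vector_space vir_scale"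
  by unfold_locales (rule poly_mapping_eqI; simp add: lookup_vir_scale lookup_add algebra_simps)+

text \<open>Operators satisfying the relations extend linearly from the basis, and bilinearity
  reduces the bracket identity to basis elements.\<close>

lemma virasoro_rep_exists:
  fixes sc :: "complex \<Rightarrow> 'v::ab_group_add \<Rightarrow> 'v" and L :: "int \<Rightarrow> 'v \<Rightarrow> 'v"
  assumes L: "\<And>n. Vector_Spaces.linear sc sc (L n)"
    and comm: "\<And>n m v. L n (L m v) - L m (L n v) = sc (of_int (n - m)) (L (n + m) v)
      + (if n + m = 0 then sc (c / 12 * of_int (n ^ 3 - n)) v else 0)"
  shows "\<exists>\<rho>. virasoro_rep sc \<rho> \<and> (\<forall>n. \<rho> (vir_L n) = L n) \<and> \<rho> vir_C = sc c"
proof -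
  interpret vector_space sc
    using L[of 0] by (simp add: Vector_Spaces.linear_iff)
  define act where "act = case_vir_basis L (sc c)"
  have act_simps [simp]: "act (VL n) = L n" "act VC = sc c" for n
    by (simp_all add: act_def)
  have act: "Vector_Spaces.linear sc sc (act g)" for g
    using L by (cases g) (auto simp: Vector_Spaces.linear_iff vector_space_axioms algebra_simps)
  then have act_scale: "act g (sc s v) = sc s (act g v)" and act_add: "act g (v + w) = act g v + act g w"
    and act_sum: "act g (sum F A) = (\<Sum>i\<in>A. act g (F i))"
    for g s v w A and F :: "vir_basis \<Rightarrow> 'v"
    by (simp_all add: Vector_Spaces.linear_iff module_hom.sum[OF module_hom_linearI[OF act]])
  define \<rho> where "\<rho> a v = (\<Sum>g\<in>Poly_Mapping.keys a. sc (Poly_Mapping.lookup a g) (act g v))" for a v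
  have \<rho>_eq: "\<rho> a v = (\<Sum>g\<in>K. sc (Poly_Mapping.lookup a g) (act g v))"
    if "finite K" "Poly_Mapping.keys a \<subseteq> K" for a v K
    unfolding \<rho>_def using that by (intro sum.mono_neutral_left) (auto simp: in_keys_iff)
  have \<rho>_single: "\<rho> (Poly_Mapping.single g s) v = sc s (act g v)" for g s v
    by (simp add: \<rho>_def)
  have lin_v: "Vector_Spaces.linear sc sc (\<rho> a)" for a
    unfolding Vector_Spaces.linear_iff \<rho>_def
    by (simp add: vector_space_axioms act_add act_scale sum.distrib scale_sum_right mult.commute
        scale_right_distrib)
  have lin_a: "Vector_Spaces.linear vir_scale sc (\<lambda>a. \<rho> a v)" for v
    unfolding Vector_Spaces.linear_iff
  proof (intro conjI allI vector_space_vir_scale vector_space_axioms)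
    show "\<rho> (a + b) v = \<rho> a v + \<rho> b v" for a b
    proof -
      define K where "K = Poly_Mapping.keys a \<union> Poly_Mapping.keys b"
      have K: "finite K" by (simp add: K_def)
      have "\<rho> (a + b) v = (\<Sum>g\<in>K. sc (Poly_Mapping.lookup (a + b) g) (act g v))"
        using K keys_add[of a b] by (intro \<rho>_eq) (auto simp: K_def)
      also have "\<dots> = \<rho> a v + \<rho> b v"
        using K by (simp add: \<rho>_eq[of K] K_def lookup_add scale_left_distrib sum.distrib)
      finally show ?thesis .
    qed
    show "\<rho> (vir_scale s a) v = sc s (\<rho> a v)" for s a
    proof -
      have "\<rho> (vir_scale s a) v =
          (\<Sum>g\<in>Poly_Mapping.keys a. sc (Poly_Mapping.lookup (vir_scale s a) g) (act g v))"
        by (intro \<rho>_eq) (auto simp: in_keys_iff lookup_vir_scale)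
      then show ?thesis by (simp add: lookup_vir_scale \<rho>_def scale_sum_right)
    qed
  qed
  have \<rho>_add: "\<rho> (a + b) v = \<rho> a v + \<rho> b v" and \<rho>_scale: "\<rho> (vir_scale s a) v = sc s (\<rho> a v)"
    and \<rho>_sum: "\<rho> (sum F A) v = (\<Sum>i\<in>A. \<rho> (F i) v)" for a b v s A and F :: "vir_basis \<Rightarrow> vir"
    using lin_a[of v] module_hom.sum[OF module_hom_linearI[OF lin_a[of v]]]
    by (simp_all add: Vector_Spaces.linear_iff)
  have \<rho>_0: "\<rho> 0 v = 0" for v by (simp add: \<rho>_def)
  have basis: "\<rho> (vir_basis_bracket g h) v = act g (act h v) - act h (act g v)" for g h v
  proof (cases "(g, h)" rule: vir_basis_bracket.cases)
    case (1 n m)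
    have "\<rho> (vir_basis_bracket (VL n) (VL m)) v = sc (of_int (n - m)) (L (n + m) v)
      + (if n + m = 0 then sc (c / 12 * of_int (n ^ 3 - n)) v else 0)"
      by (simp add: \<rho>_add \<rho>_single \<rho>_0 mult.commute)
    then show ?thesis using 1 by (simp add: comm)
  \<comment> \<open>Brackets with \<open>VC\<close> are 0, and the scalar \<open>c\<close> commutes
    with the linear operators.\<close>
  qed (simp_all add: \<rho>_0 act_scale flip: act_simps(2), simp_all add: act_scale)
  have "\<rho> (vir_bracket a b) v = \<rho> a (\<rho> b v) - \<rho> b (\<rho> a v)" for a b v
  proof -
    define s where "s g h = Poly_Mapping.lookup a g * Poly_Mapping.lookup b h" for g h
    have 1: "\<rho> a (\<rho> b v) = (\<Sum>g\<in>Poly_Mapping.keys a. \<Sum>h\<in>Poly_Mapping.keys b. sc (s g h) (act g (act h v)))"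
      by (simp add: \<rho>_def act_sum act_scale scale_sum_right s_def)
    have "\<rho> b (\<rho> a v) = (\<Sum>h\<in>Poly_Mapping.keys b. \<Sum>g\<in>Poly_Mapping.keys a. sc (s g h) (act h (act g v)))"
      by (simp add: \<rho>_def act_sum act_scale scale_sum_right s_def mult.commute)
    also have "\<dots> = (\<Sum>g\<in>Poly_Mapping.keys a. \<Sum>h\<in>Poly_Mapping.keys b. sc (s g h) (act h (act g v)))"
      by (rule sum.swap)
    finally have 2: "\<rho> b (\<rho> a v) = \<dots>" .
    show ?thesis
      unfolding vir_bracket_def \<rho>_sum \<rho>_scale basis 1 2
      by (simp add: scale_right_diff_distrib sum_subtractf s_def)
  qed
  with lin_v lin_a have "virasoro_rep sc \<rho>" by (simp add: virasoro_rep_def)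
  moreover have "\<rho> (vir_L n) = L n" "\<rho> vir_C = sc c" for n
    by (auto simp: vir_L_def vir_C_def \<rho>_single)
  ultimately show ?thesis by blast
qed

section \<open>The generating series\<close>

text \<open>Compare coefficients of \<open>\<zeta>^a \<xi>^b\<close>, that is, set
  \<open>n = - 2 - a\<close> and \<open>m = - 2 - b\<close>.\<close>

lemma stress_tensor_commutator:
  fixes sc :: "complex \<Rightarrow> 'v::ab_group_add \<Rightarrow> 'v" and L :: "int \<Rightarrow> 'v \<Rightarrow> 'v"
  assumes "vector_space sc"
    and comm: "\<And>n m v. L n (L m v) - L m (L n v) = sc (of_int (n - m)) (L (n + m) v)
      + (if n + m = 0 then sc (c / 12 * of_int (n ^ 3 - n)) v else 0)"
  defines "T \<equiv> stress_tensor L"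
  shows "T a (T b v) - T b (T a v) =
    sc (1 / fact 3 * d_xi2 (d_xi2 (d_xi2 delta2)) a b * (c / 2)) v
    + dist_mult sc (d_xi2 delta2) (\<lambda>k w. sc 2 (T k w)) a b v
    + dist_mult sc delta2 (d_dist sc T) a b v"
proof -
  interpret vector_space sc by fact
  have delta: "delta2 a b = (if a + b = - 1 then 1 else 0)" for a b
    by (auto simp: delta2_def)
  have central: "sc (1 / fact 3 * d_xi2 (d_xi2 (d_xi2 delta2)) a b * (c / 2)) v =
      (if (- 2 - a) + (- 2 - b) = 0 then sc (c / 12 * of_int ((- 2 - a) ^ 3 - (- 2 - a))) v else 0)"
  \<comment> \<open>On the support \<open>n = b + 2\<close>, so the factor
    \<open>(b+1)(b+2)(b+3)\<close> from three derivatives is \<open>n^3 - n\<close>; the constants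
    1/6 and 1/2 give 1/12.\<close>
  proof (cases "a + b = - 4")
    case True
    then have a: "a = - 4 - b" by simp
    show ?thesis
      unfolding d_xi2_def delta a
      by (simp add: fact_numeral power3_eq_cube field_simps)
  next
    case False
    then show ?thesis by (simp add: d_xi2_def delta)
  qed
  \<comment> \<open>The only possible exponent \<open>k = - 2 - a\<close> carries the factor
    \<open>k + 1 = - 1 - a\<close>, so the support is empty for \<open>a = - 1\<close>.\<close>
  have "{k. d_xi2 delta2 a k \<noteq> 0} = (if a = - 1 then {} else {- 2 - a})"
    by (auto simp: d_xi2_def delta simp del: of_int_add of_int_1)
  moreover have "d_xi2 delta2 a (- 2 - a) = of_int (- 1 - a)"
    by (simp add: d_xi2_def delta)
  moreover have "of_int (- 1 - a) * 2 = (of_int (- 2 - 2 * a) :: complex)"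
    by simp
  ultimately have first: "dist_mult sc (d_xi2 delta2) (\<lambda>k w. sc 2 (T k w)) a b v =
      sc (of_int (- 2 - 2 * a)) (T (b + 2 + a) v)"
    by (cases "a = - 1") (simp_all add: dist_mult_def algebra_simps del: of_int_diff of_int_mult)
  have "{k. delta2 a k \<noteq> 0} = {- 1 - a}"
    by (auto simp: delta)
  then have "dist_mult sc delta2 (d_dist sc T) a b v = sc (delta2 a (- 1 - a)) (d_dist sc T (b - (- 1 - a)) v)"
    by (simp add: dist_mult_def)
  also have "b - (- 1 - a) = b + 1 + a" by simp
  also have "delta2 a (- 1 - a) = 1" by (simp add: delta)
  finally have second: "dist_mult sc delta2 (d_dist sc T) a b v =
      sc (of_int (b + 1 + a + 1)) (T (b + 1 + a + 1) v)"
    by (simp only: d_dist_def[of sc T "b + 1 + a" v] scale_one)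
  have "b + 1 + a + 1 = b + 2 + a" by simp
  note second = second[unfolded this]
  have "T (b + 2 + a) = L ((- 2 - a) + (- 2 - b))"
    unfolding T_def stress_tensor_def by (rule arg_cong[of _ _ L]) simp
  \<comment> \<open>The two coefficients add up to \<open>b - a\<close>, which is
    \<open>n - m\<close>.\<close>
  then have "sc (of_int (- 2 - 2 * a)) (T (b + 2 + a) v) + sc (of_int (b + 2 + a)) (T (b + 2 + a) v) =
      sc (of_int ((- 2 - a) - (- 2 - b))) (L ((- 2 - a) + (- 2 - b)) v)"
    by (simp flip: scale_left_distrib)
  then show ?thesis
    unfolding central first second add.assoc unfolding T_def stress_tensor_def comm by simp
qed

theorem corollary4p2:
  fixes N M :: nat
    and c :: complex
    and dx dy :: "nat \<Rightarrow> complex"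
    and ix iy :: "nat \<Rightarrow> 'd::{finite,linorder}"
  assumes "N \<ge> 1"
    and "bij_betw (case_sum ix iy) ({1..N} <+> {1..M}) (UNIV :: 'd set)"
  shows "let L = Lop c N M ix iy dx dy; T = stress_tensor L in
    (\<forall>n m P. L n (L m P) - L m (L n P) =
       scaleF (of_int (n - m)) (L (n + m) P)
       + (if n + m = 0 then scaleF (c / 12 * of_int (n ^ 3 - n)) P else 0)) \<and>
    (\<exists>\<rho>. virasoro_rep scaleF \<rho> \<and> (\<forall>n. \<rho> (vir_L n) = L n) \<and> \<rho> vir_C = scaleF c) \<and>
    (\<forall>a b P. T a (T b P) - T b (T a P) =
       scaleF (1 / fact 3 * d_xi2 (d_xi2 (d_xi2 delta2)) a b * (c / 2)) P
       + dist_mult scaleF (d_xi2 delta2) (\<lambda>k Q. scaleF 2 (T k Q)) a b P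
       + dist_mult scaleF delta2 (d_dist scaleF T) a b P)"
proof -
  define L where "L = Lop c N M ix iy dx dy"
  have comm: "L n (L m P) - L m (L n P) = scaleF (of_int (n - m)) (L (n + m) P)
      + (if n + m = 0 then scaleF (c / 12 * of_int (n ^ 3 - n)) P else 0)" for n m P
    unfolding L_def by (rule Lop_commutator[OF assms(2)])
  have "Vector_Spaces.linear scaleF scaleF (L n)" for n
    unfolding Vector_Spaces.linear_iff L_def using vector_space_scaleF Lop_linear[OF assms(2)] by blast
  from virasoro_rep_exists[OF this comm] comm stress_tensor_commutator[OF vector_space_scaleF comm]
  show ?thesis
    unfolding Let_def L_def[symmetric] by blast
qed

end
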